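(* Let $A$ be a finite set, let $\Omega_\bullet=(\Omega_m:m\ge1)$ be a permutation-invariant and deletion-compatible support family with $\Omega_m\subseteq A^m$, and for $m\ge 1$ let $\mathcal N_m=\mathcal N_m(\Omega_\bullet)$ be the family of exchangeable Lorentzian laws supported on $\Omega_m$. Let $m\ge2$. For any $\mu\in\mathcal N_m$ and $X=(X_1,\dots,X_m)\sim\mu$, $$\sum_{j=1}^m \mathrm H(X_{[m]\setminus j})\ \ge\ (m-2)\,\mathrm H(X)+\sum_{j=1}^m \mathrm H(X_j).$$
   Context: A law is a probability measure on a finite set. $[m]=\{1,\dots,m\}$. For $X=(X_1,\dots,X_m)$, $X_{[m]\setminus j}$ denotes $(X_i:i\in[m],i\ne j)$, and similarly $\boldsymbol\omega_{[m]\setminus j}$ is obtained from $\boldsymbol\omega$ by deleting the $j$-th coordinate. $\mathrm H(Y)=-\sum_y\Pr(Y=y)\log\Pr(Y=y)$ is the Shannon entropy (natural logarithm, $0\log0=0$). A support family $\Omega_\bullet=(\Omega_m:m\ge1)$ with $\Omega_m\subseteq A^m$ is permutation-invariant if each $\Omega_m$ is invariant under permutations of the $m$ coordinate positions, and deletion-compatible if for each $m\ge2$, $\boldsymbol\omega\in\Omega_m$ implies $\boldsymbol\omega_{[m]\setminus j}\in\Omega_{m-1}$ for all $j\in[m]$. A law on $A^m$ is exchangeable if it is invariant under permutations of the coordinate positions. A law on $\Omega_m$ is identified with the law on $A^m$ that assigns mass zero to $A^m\setminus\Omega_m$. For $\boldsymbol\omega\in A^m$, the count vector is $T(\boldsymbol\omega)=(|\{j\in[m]:\omega_j=a\}|:a\in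 A)\in\mathbb{N}_0^A$. The count-generating polynomial of a law $\mu$ on $A^m$ is $h_\mu(\mathbf x)=\mathbb{E}_{X\sim\mu}\,\mathbf x^{T(X)}$, where $\mathbf x^{\mathbf n}=\prod_{a\in A}x_a^{n_a}$. A law $\mu$ on $A^m$ is called Lorentzian if $h_\mu$ is a Lorentzian polynomial. Lorentzian polynomials: a symmetric entrywise-nonnegative matrix is antiferromagnetic if it has at most one positive eigenvalue counted with multiplicity. A set $S\subseteq\mathbb{N}_0^I$ ($I$ finite) is M-convex if for all $\boldsymbol\alpha,\boldsymbol\beta\in S$ and $\sigma\in I$ with $\alpha_\sigma>\beta_\sigma$ there is $\tau\in I$ with $\alpha_\tau<\beta_\tau$, $\boldsymbol\alpha-\mathbf e_\sigma+\mathbf e_\tau\in S$ and $\boldsymbol\beta-\mathbf e_\tau+\mathbf e_\sigma\in S$, where $\mathbf e_\sigma$ are the standard unit vectors. The support of a polynomial is the set of exponents of monomials with nonzero coefficient. A polynomial $f\in\mathbb{R}_{\ge0}[x_\sigma:\sigma\in I]$ of degree $d$ is Lorentzian if either $f$ is a constant, or $d\ge1$ and: (1) $f$ is homogeneous with M-convex support; (2) if $d=2$, the Hessian $\nabla^2f$ is antiferromagnetic; (3) if $d\ge3$, for each $\sigma\in I$ the partial derivative $\partial_\sigma f$ is either zero or Lorentzian (recursively). *)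

theory Defs
  imports
    "HOL-Probability.Probability_Mass_Function"
    "HOL-Combinatorics.Permutations"
    "HOL-Library.Poly_Mapping"
    "Jordan_Normal_Form.Char_Poly"
begin

section \<open>Lorentzian polynomials\<close>

text \<open>
  A monomial \<open>x\<^sup>n\<close> is its finitely supported exponent vector \<open>n\<close>, and a polynomial is the
  finitely supported map from exponent vectors to coefficients; its support is \<^term>\<open>Poly_Mapping.keys\<close>.
  The variables are the elements of a finite set \<open>I\<close> of the type \<open>'i\<close>.
\<close>

type_synonym 'i expvec = "'i \<Rightarrow>\<^sub>0 nat"
type_synonym 'i rpoly = "'i expvec \<Rightarrow>\<^sub>0 real"

abbreviation unit_vec :: "'i \<Rightarrow> 'i expvec" where
  "unit_vec i \<equiv> Poly_Mapping.single i 1"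

definition nonneg_polys :: "'i set \<Rightarrow> 'i rpoly set" where
  "nonneg_polys I = {f. (\<forall>n\<in>Poly_Mapping.keys f. Poly_Mapping.keys n \<subseteq> I)
                      \<and> (\<forall>n. 0 \<le> Poly_Mapping.lookup f n)}"

definition expvec_degree :: "'i expvec \<Rightarrow> nat" where
  "expvec_degree n = (\<Sum>i\<in>Poly_Mapping.keys n. Poly_Mapping.lookup n i)"

text \<open>The zero polynomial gets degree 0, so that having degree 0 means being constant.\<close>

definition total_degree :: "'i rpoly \<Rightarrow> nat" where
  "total_degree f = Max (insert 0 (expvec_degree ` Poly_Mapping.keys f))"

definition homogeneous :: "'i rpoly \<Rightarrow> bool" where
  "homogeneous f \<longleftrightarrow> (\<exists>d. \<forall>n\<in>Poly_Mapping.keys f. expvec_degree n = d)"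

text \<open>
  Where \<open>i\<close> does not occur in \<open>n\<close>, the truncated subtraction \<open>n - unit_vec i\<close> is harmless, since the
  coefficient is then zero.
\<close>

definition partial_deriv :: "'i \<Rightarrow> 'i rpoly \<Rightarrow> 'i rpoly" where
  "partial_deriv i f = (\<Sum>n\<in>Poly_Mapping.keys f.
     Poly_Mapping.single (n - unit_vec i)
       (real (Poly_Mapping.lookup n i) * Poly_Mapping.lookup f n))"

lemma lookup_partial_deriv:
  "Poly_Mapping.lookup (partial_deriv i f) n =
     real (Poly_Mapping.lookup n i + 1) * Poly_Mapping.lookup f (n + unit_vec i)"
proof -
  have shift: "k = n + unit_vec i \<longleftrightarrow> k - unit_vec i = n"
    if "Poly_Mapping.lookup k i \<noteq> 0" for k
    using that
    by (auto simp: poly_mapping_eq_iff fun_eq_iff lookup_add lookup_minus lookup_single when_def)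
  have "Poly_Mapping.lookup (partial_deriv i f) n =
    (\<Sum>k\<in>Poly_Mapping.keys f.
       real (Poly_Mapping.lookup k i) * Poly_Mapping.lookup f k when k - unit_vec i = n)"
    by (simp add: partial_deriv_def lookup_sum lookup_single)
  also have "\<dots> = (\<Sum>k\<in>Poly_Mapping.keys f. if k = n + unit_vec i
       then real (Poly_Mapping.lookup k i) * Poly_Mapping.lookup f k else 0)"
  proof (intro sum.cong refl)
    fix k
    show "(real (Poly_Mapping.lookup k i) * Poly_Mapping.lookup f k when k - unit_vec i = n) =
        (if k = n + unit_vec i
         then real (Poly_Mapping.lookup k i) * Poly_Mapping.lookup f k else 0)"
      using shift[of k] by (cases "Poly_Mapping.lookup k i = 0") (auto simp: when_def)
  qed
  also have "\<dots> = real (Poly_Mapping.lookup n i + 1) * Poly_Mapping.lookup f (n + unit_vec i)"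
    by (simp add: sum.delta' lookup_add lookup_single in_keys_iff)
  finally show ?thesis .
qed

definition m_convex :: "'i set \<Rightarrow> 'i expvec set \<Rightarrow> bool" where
  "m_convex I S \<longleftrightarrow>
     (\<forall>\<alpha>\<in>S. \<forall>\<beta>\<in>S. \<forall>\<sigma>\<in>I. Poly_Mapping.lookup \<alpha> \<sigma> > Poly_Mapping.lookup \<beta> \<sigma> \<longrightarrow>
        (\<exists>\<tau>\<in>I. Poly_Mapping.lookup \<alpha> \<tau> < Poly_Mapping.lookup \<beta> \<tau>
              \<and> \<alpha> - unit_vec \<sigma> + unit_vec \<tau> \<in> S
              \<and> \<beta> - unit_vec \<tau> + unit_vec \<sigma> \<in> S))"

text \<open>
  Eigenvalues are counted as roots of the characteristic polynomial, with multiplicity. The list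
  \<open>xs\<close> only numbers the rows and columns: different enumerations of \<open>I\<close> give permutation-similar
  matrices, so the choice does not matter.
\<close>

definition indexed_mat :: "'i list \<Rightarrow> ('i \<Rightarrow> 'i \<Rightarrow> real) \<Rightarrow> real mat" where
  "indexed_mat xs M = mat (length xs) (length xs) (\<lambda>(k, l). M (xs ! k) (xs ! l))"

definition antiferromagnetic :: "'i set \<Rightarrow> ('i \<Rightarrow> 'i \<Rightarrow> real) \<Rightarrow> bool" where
  "antiferromagnetic I M \<longleftrightarrow>
     (\<forall>i\<in>I. \<forall>j\<in>I. M i j = M j i \<and> 0 \<le> M i j) \<and>
     (\<exists>xs. distinct xs \<and> set xs = I \<and>
        size (filter_mset (\<lambda>e. 0 < e) (proots (char_poly (indexed_mat xs M)))) \<le> 1)"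

text \<open>
  Only used for homogeneous polynomials of degree 2, whose second partial derivatives are constant
  polynomials; the entry is that constant.
\<close>

definition hessian :: "'i rpoly \<Rightarrow> 'i \<Rightarrow> 'i \<Rightarrow> real" where
  "hessian f i j = Poly_Mapping.lookup (partial_deriv i (partial_deriv j f)) 0"

inductive lorentzian :: "'i set \<Rightarrow> 'i rpoly \<Rightarrow> bool" for I where
  const: "f \<in> nonneg_polys I \<Longrightarrow> total_degree f = 0 \<Longrightarrow> lorentzian I f"
| step:
    "f \<in> nonneg_polys I \<Longrightarrow> total_degree f \<ge> 1 \<Longrightarrow>
     homogeneous f \<Longrightarrow> m_convex I (Poly_Mapping.keys f) \<Longrightarrow>
     (total_degree f = 2 \<Longrightarrow> antiferromagnetic I (hessian f)) \<Longrightarrow>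
     (\<And>\<sigma>. total_degree f \<ge> 3 \<Longrightarrow> \<sigma> \<in> I \<Longrightarrow>
        partial_deriv \<sigma> f = 0 \<or> lorentzian I (partial_deriv \<sigma> f)) \<Longrightarrow>
     lorentzian I f"


section \<open>Laws on tuples\<close>

text \<open>
  An element of \<open>A\<^sup>m\<close> is a list of length \<open>m\<close> over \<open>A\<close>, so coordinate positions are
  \<open>0, \<dots>, m - 1\<close>. A law is a \<^typ>\<open>'a list pmf\<close>; it is a law on \<open>\<Omega>\<close> when its support
  is contained in \<open>\<Omega>\<close>.
\<close>

definition tuples :: "'a set \<Rightarrow> nat \<Rightarrow> 'a list set" where
  "tuples A m = {\<omega>. length \<omega> = m \<and> set \<omega> \<subseteq> A}"

definition delete_coord :: "nat \<Rightarrow> 'a list \<Rightarrow> 'a list" where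
  "delete_coord j \<omega> = nths \<omega> (- {j})"

definition permutation_invariant :: "(nat \<Rightarrow> 'a list set) \<Rightarrow> bool" where
  "permutation_invariant \<Omega> \<longleftrightarrow>
     (\<forall>m\<ge>1. \<forall>\<pi>. \<pi> permutes {..<m} \<longrightarrow> permute_list \<pi> ` \<Omega> m = \<Omega> m)"

definition deletion_compatible :: "(nat \<Rightarrow> 'a list set) \<Rightarrow> bool" where
  "deletion_compatible \<Omega> \<longleftrightarrow>
     (\<forall>m\<ge>2. \<forall>\<omega>\<in>\<Omega> m. \<forall>j<m. delete_coord j \<omega> \<in> \<Omega> (m - 1))"

definition exchangeable :: "nat \<Rightarrow> 'a list pmf \<Rightarrow> bool" where
  "exchangeable m \<mu> \<longleftrightarrow> (\<forall>\<pi>. \<pi> permutes {..<m} \<longrightarrow> map_pmf (permute_list \<pi>) \<mu> = \<mu>)"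

definition count_vector :: "'a list \<Rightarrow> 'a expvec" where
  "count_vector \<omega> = (\<Sum>a\<in>set \<omega>. Poly_Mapping.single a (count_list \<omega> a))"

lemma lookup_count_vector: "Poly_Mapping.lookup (count_vector \<omega>) a = count_list \<omega> a"
proof -
  have "Poly_Mapping.lookup (count_vector \<omega>) a =
      (\<Sum>b\<in>set \<omega>. if b = a then count_list \<omega> b else 0)"
    by (simp add: count_vector_def lookup_sum lookup_single when_def)
  also have "\<dots> = count_list \<omega> a"
    by (auto simp: count_list_0_iff)
  finally show ?thesis .
qed

definition count_gen_poly :: "'a list pmf \<Rightarrow> 'a rpoly" where
  "count_gen_poly \<mu> = (\<Sum>\<omega>\<in>set_pmf \<mu>. Poly_Mapping.single (count_vector \<omega>) (pmf \<mu> \<omega>))"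

definition exch_lorentzian_laws :: "'a set \<Rightarrow> (nat \<Rightarrow> 'a list set) \<Rightarrow> nat \<Rightarrow> 'a list pmf set" where
  "exch_lorentzian_laws A \<Omega> m =
     {\<mu>. set_pmf \<mu> \<subseteq> \<Omega> m \<and> exchangeable m \<mu> \<and> lorentzian A (count_gen_poly \<mu>)}"

text \<open>The entropy of \<open>Y(X)\<close> for \<open>X\<close> of law \<open>\<mu>\<close> with finite support.\<close>

definition shannon_entropy :: "'b pmf \<Rightarrow> ('b \<Rightarrow> 'c) \<Rightarrow> real" where
  "shannon_entropy \<mu> Y =
     - (\<Sum>y\<in>set_pmf (map_pmf Y \<mu>). pmf (map_pmf Y \<mu>) y * ln (pmf (map_pmf Y \<mu>) y))"

end

theory Submission
  imports Defs
    "Jordan_Normal_Form.Schur_Decomposition"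
    "Jordan_Normal_Form.Spectral_Radius"
    "HOL-Combinatorics.Multiset_Permutations"
begin

text \<open>
  The polar form of a Lorentzian polynomial satisfies the Alexandrov-Fenchel inequality: for quadratic
  forms this is the reverse Cauchy-Schwarz inequality of a form with at most one positive eigenvalue,
  and a local-to-global argument, whose connectivity hypothesis is supplied by M-convexity, raises the
  degree. Exchangeability means that the law itself is the tensor of the polar form, so that passing to
  a marginal or conditioning on a coordinate is a directional derivative and preserves the inequality.

  For a law of \<open>d\<close> coordinates the inequality makes \<open>j \<mapsto> E(x(X\<^sub>1) \<cdots> x(X\<^sub>j))\<close> log-concave, so its value at
  \<open>d\<close> is at most the \<open>d\<close>-th power of its value at \<open>1\<close>. Together with Gibbs' inequality this gives
  \<open>I(X\<^sub>m; X\<^sub>1, \<dots>, X\<^sub>m\<^sub>-\<^sub>1) \<ge> (m - 1) I(X\<^sub>m; X\<^sub>1)\<close>. Adding it to the claim for \<open>m - 1\<close> coordinates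
  conditioned on \<open>X\<^sub>m\<close> yields the claim for \<open>m\<close>.
\<close>

unbundle no inner_syntax and no vec_syntax

section \<open>Real symmetric matrices\<close>

text \<open>Weights are functions of a multiset, so the order of coordinates never has to be
  tracked: conditioning on a coordinate is \<open>shift\<close>, summing one out is
  \<open>dderiv\<close> in the all-ones direction, and the two commute. Conditioning does not
  renormalise; \<open>tuple_entropy A 0\<close>, which vanishes at total mass 1, is carried along to
  keep the entropy inequalities invariant under scaling.

  For X_0 = c, Gibbs' inequality is applied to the law of the other coordinates tilted by the
  product of x(a) = P(a,c) Z / (p(a) p(c)). This x has mean 1, so log-concavity of the moments
  bounds the mass of the tilted weights by that of the true ones. The logarithm of the tilt is
  additive over coordinates, which produces the factor m - 1 in front of I(X_m; X_1).

  On the Lorentzian side the obstacle is that directions with zero entries can disconnect the matrix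
  in the local-to-global step. Strictly positive directions come first, where the support alone
  decides which entries are positive, and the general case is a limit.\<close>

lemma symmetric_mat_eigenvalue:
  fixes A :: "real mat"
  assumes A: "A \<in> carrier_mat n n" and sym: "transpose_mat A = A" and n: "n \<noteq> 0"
  obtains e where "eigenvalue A e"
proof -
  let ?C = "map_mat complex_of_real A"
  have C: "?C \<in> carrier_mat n n" using A by auto
  obtain k where k: "eigenvalue ?C k"
    using spectrum_non_empty[OF C] n unfolding spectrum_def by auto
  then obtain v where v: "v \<in> carrier_vec n" "v \<noteq> 0\<^sub>v n" "?C *\<^sub>v v = k \<cdot>\<^sub>v v"
    using C unfolding eigenvalue_def eigenvector_def by auto
  have cC: "conjugate (?C *\<^sub>v v) = ?C *\<^sub>v conjugate v"
  proof (rule eq_vecI)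
    fix i assume "i < dim_vec (?C *\<^sub>v conjugate v)"
    then have i: "i < n" using C by auto
    then show "conjugate (?C *\<^sub>v v) $ i = (?C *\<^sub>v conjugate v) $ i"
      using C v(1) by (auto simp: scalar_prod_def conjugate_complex_def)
  qed (use C in auto)
  \<comment> \<open>Evaluating the Hermitian pairing of C v with v on either side gives
    \<open>k\<close> and its conjugate times the same nonzero number, so the complex eigenvalue is
    real.\<close>
  have "k * (v \<bullet>c v) = (?C *\<^sub>v v) \<bullet>c v"
    using v by simp
  also have "\<dots> = v \<bullet> (?C *\<^sub>v conjugate v)"
  proof -
    have "(transpose_mat ?C *\<^sub>v v) \<bullet> conjugate v = v \<bullet> (?C *\<^sub>v conjugate v)"
      by (rule transpose_vec_mult_scalar[OF C]) (use v in auto)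
    moreover have "transpose_mat ?C = ?C"
      using sym by (metis map_mat_transpose)
    ultimately show ?thesis by simp
  qed
  also have "\<dots> = v \<bullet> conjugate (k \<cdot>\<^sub>v v)"
    by (simp only: cC[symmetric] v(3))
  also have "\<dots> = cnj k * (v \<bullet>c v)"
    using v by (simp add: conjugate_smult_vec)
  finally have "k = cnj k"
    using v conjugate_square_eq_0_vec[OF v(1)] by auto
  then have re: "k = complex_of_real (Re k)"
    by (metis Reals_cnj_iff complex_is_Real_iff of_real_Re)
  have "poly (char_poly ?C) k = 0"
    using eigenvalue_root_char_poly[OF C] k by simp
  then have "poly (char_poly A) (Re k) = 0"
    by (metis of_real_hom.char_poly_hom[OF A] of_real_hom.poly_map_poly of_real_eq_0_iff re)
  then show ?thesis
    using eigenvalue_root_char_poly[OF A] that by blast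
qed

text \<open>Gram-Schmidt leaves the head of its input unchanged, so from a basis with head
  \<open>v\<close> the first orthonormal column still points along \<open>v\<close>. With
  \<open>v\<close> an eigenvector this deflates a symmetric matrix.\<close>

lemma orthonormal_completion:
  fixes v :: "real vec"
  assumes v: "v \<in> carrier_vec n" and v0: "v \<noteq> 0\<^sub>v n"
  obtains W c where "W \<in> carrier_mat n n" "transpose_mat W * W = 1\<^sub>m n" "col W 0 = c \<cdot>\<^sub>v v" "c \<noteq> 0"
proof -
  interpret cof_vec_space n "TYPE(real)" .
  define b where "b = basis_completion v"
  define ws where "ws = gram_schmidt n b"
  note bc = basis_completion[OF v v0, folded b_def]
  have n: "n \<noteq> 0" using v v0 by (intro notI) auto
  obtain vs where bv: "b = v # vs"
    using bc n by (cases b) auto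
  have ws: "set ws \<subseteq> carrier_vec n" "corthogonal ws" "length ws = n"
    using gram_schmidt_result[OF bc(2) bc(4) bc(5) refl, folded ws_def] bc by auto
  have hd: "hd ws = v"
    using gram_schmidt_hd[OF v, of vs, folded bv] unfolding ws_def .
  have ws0: "ws ! 0 = v"
    using hd ws(3) n by (metis hd_conv_nth length_0_conv)
  define W where "W = mat n n (\<lambda>(k, i). (ws ! i) $ k / sqrt (ws ! i \<bullet> ws ! i))"
  have W: "W \<in> carrier_mat n n" by (simp add: W_def)
  have wsi: "ws ! i \<in> carrier_vec n" if "i < n" for i using ws that by auto
  have orth: "ws ! i \<bullet> ws ! j = 0 \<longleftrightarrow> i \<noteq> j" if "i < n" "j < n" for i j
    using corthogonalD[OF ws(2)] that ws(3) by (auto simp: conjugate_vec_def)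
  have pos: "ws ! i \<bullet> ws ! i > 0" if "i < n" for i
    using orth[OF that that] by (auto simp: order_less_le scalar_prod_def intro!: sum_nonneg)
  have "transpose_mat W * W = 1\<^sub>m n"
  proof (rule eq_matI)
    fix i j assume "i < dim_row (1\<^sub>m n :: real mat)" "j < dim_col (1\<^sub>m n :: real mat)"
    then have ij: "i < n" "j < n" by auto
    have "(transpose_mat W * W) $$ (i, j) =
        (\<Sum>k<n. (ws ! i) $ k / sqrt (ws ! i \<bullet> ws ! i) * ((ws ! j) $ k / sqrt (ws ! j \<bullet> ws ! j)))"
      using ij W by (simp add: W_def scalar_prod_def atLeast0LessThan)
    also have "\<dots> = (\<Sum>k<n. (ws ! i) $ k * (ws ! j) $ k) / (sqrt (ws ! i \<bullet> ws ! i) * sqrt (ws ! j \<bullet> ws ! j))"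
      by (simp add: sum_divide_distrib)
    also have "(\<Sum>k<n. (ws ! i) $ k * (ws ! j) $ k) = ws ! i \<bullet> ws ! j"
      using wsi[OF ij(2)] by (simp add: scalar_prod_def atLeast0LessThan)
    also have "ws ! i \<bullet> ws ! j / (sqrt (ws ! i \<bullet> ws ! i) * sqrt (ws ! j \<bullet> ws ! j)) = 1\<^sub>m n $$ (i, j)"
      using orth[OF ij] pos[OF ij(1)] ij by (cases "i = j") auto
    finally show "(transpose_mat W * W) $$ (i, j) = 1\<^sub>m n $$ (i, j)" .
  qed (use W in auto)
  moreover have "col W 0 = (1 / sqrt (v \<bullet> v)) \<cdot>\<^sub>v v"
    using ws0 ws(3) n v by (intro eq_vecI) (auto simp: W_def)
  moreover have "1 / sqrt (v \<bullet> v) \<noteq> 0"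
    using pos[of 0] ws0 n by simp
  ultimately show ?thesis using that W by blast
qed

text \<open>Deflation: conjugation by an orthogonal matrix whose first column is an eigenvector
  clears the rest of the first column, symmetry clears the first row, and induction diagonalises the
  remaining block.\<close>

lemma real_symmetric_diagonalization:
  fixes A :: "real mat"
  assumes "A \<in> carrier_mat n n" and "transpose_mat A = A"
  shows "\<exists>P es. P \<in> carrier_mat n n \<and> transpose_mat P * P = 1\<^sub>m n \<and>
           transpose_mat P * A * P = mat n n (\<lambda>(i, j). if i = j then es i else 0)"
  using assms
proof (induction n arbitrary: A)
  case 0
  then show ?case by (intro exI[of _ "1\<^sub>m 0"] exI[of _ "\<lambda>_. 0"]) auto
next
  case (Suc n)
  note A = Suc.prems(1) and sym = Suc.prems(2)
  obtain e where "eigenvalue A e"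
    using symmetric_mat_eigenvalue[OF A sym] by auto
  then obtain v where v: "v \<in> carrier_vec (Suc n)" "v \<noteq> 0\<^sub>v (Suc n)" "A *\<^sub>v v = e \<cdot>\<^sub>v v"
    using A unfolding eigenvalue_def eigenvector_def by auto
  obtain W c where W: "W \<in> carrier_mat (Suc n) (Suc n)" "transpose_mat W * W = 1\<^sub>m (Suc n)"
    and c: "col W 0 = c \<cdot>\<^sub>v v" "c \<noteq> 0"
    using orthonormal_completion[OF v(1,2)] by blast
  define A' where "A' = transpose_mat W * A * W"
  have A': "A' \<in> carrier_mat (Suc n) (Suc n)" using A W by (simp add: A'_def)
  have symA': "transpose_mat A' = A'"
  proof -
    have "transpose_mat A' = transpose_mat W * transpose_mat (transpose_mat W * A)"
      unfolding A'_def by (rule transpose_mult) (use A W in auto)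
    also have "transpose_mat (transpose_mat W * A) = transpose_mat A * W"
      by (subst transpose_mult) (use A W in auto)
    also have "transpose_mat W * (transpose_mat A * W) = A'"
      unfolding A'_def sym by (rule assoc_mult_mat[symmetric]) (use A W in auto)
    finally show ?thesis .
  qed
  have col0: "col A' 0 = e \<cdot>\<^sub>v Matrix.unit_vec (Suc n) 0"
  proof -
    have "A' = transpose_mat W * (A * W)"
      unfolding A'_def by (rule assoc_mult_mat) (use A W in auto)
    then have "col A' 0 = transpose_mat W *\<^sub>v (A *\<^sub>v col W 0)"
      using A W col_mult2[of A "Suc n" "Suc n" W "Suc n" 0]
        col_mult2[of "transpose_mat W" "Suc n" "Suc n" "A * W" "Suc n" 0] by auto
    also have "A *\<^sub>v col W 0 = e \<cdot>\<^sub>v col W 0"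
      using v A unfolding c(1) by (simp add: mult_mat_vec smult_smult_assoc mult.commute)
    also have "transpose_mat W *\<^sub>v (e \<cdot>\<^sub>v col W 0) = e \<cdot>\<^sub>v (transpose_mat W *\<^sub>v col W 0)"
      by (rule mult_mat_vec, use W(1) in simp, rule carrier_vecI, use W(1) in simp)
    also have "transpose_mat W *\<^sub>v col W 0 = col (transpose_mat W * W) 0"
      using W(1) by (intro col_mult2[symmetric, of _ "Suc n" "Suc n" _ "Suc n"]) auto
    also have "\<dots> = Matrix.unit_vec (Suc n) 0" unfolding W(2) by simp
    finally show ?thesis .
  qed
  have A'0: "A' $$ (i, 0) = (if i = 0 then e else 0)" if "i < Suc n" for i
    using arg_cong[OF col0, of "\<lambda>v. v $ i"] that A' by auto
  have A'0': "A' $$ (0, i) = (if i = 0 then e else 0)" if "i < Suc n" for i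
    using A'0[OF that] arg_cong[OF symA', of "\<lambda>M. M $$ (i, 0)"] that A' by auto
  define B where "B = mat n n (\<lambda>(i, j). A' $$ (Suc i, Suc j))"
  have B: "B \<in> carrier_mat n n" by (simp add: B_def)
  have symB: "transpose_mat B = B"
  proof (rule eq_matI)
    fix i j assume ij: "i < dim_row B" "j < dim_col B"
    then show "transpose_mat B $$ (i, j) = B $$ (i, j)"
      using arg_cong[OF symA', of "\<lambda>M. M $$ (Suc i, Suc j)"] A' by (auto simp: B_def)
  qed (use B in auto)
  obtain Q es where Q: "Q \<in> carrier_mat n n" "transpose_mat Q * Q = 1\<^sub>m n"
    and dQ: "transpose_mat Q * B * Q = mat n n (\<lambda>(i, j). if i = j then es i else 0)"
    using Suc.IH[OF B symB] by blast
  define R where "R = four_block_mat (1\<^sub>m 1) (0\<^sub>m 1 n) (0\<^sub>m n 1) Q"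
  have R: "R \<in> carrier_mat (Suc n) (Suc n)" using Q by (auto simp: R_def)
  have tR: "transpose_mat R = four_block_mat (1\<^sub>m 1) (0\<^sub>m 1 n) (0\<^sub>m n 1) (transpose_mat Q)"
    unfolding R_def by (subst transpose_four_block_mat) (use Q in auto)
  have RR: "transpose_mat R * R = 1\<^sub>m (Suc n)"
    unfolding tR unfolding R_def
    by (subst mult_four_block_mat[where ?n1.0=1 and ?n2.0=n and ?nr1.0=1 and ?nr2.0=n and ?nc1.0=1 and ?nc2.0=n])
       (use Q in \<open>auto simp: four_block_one_mat\<close>)
  have A'b: "A' = four_block_mat (mat 1 1 (\<lambda>_. e)) (0\<^sub>m 1 n) (0\<^sub>m n 1) B"
    by (rule eq_matI) (use A' A'0 A'0' in \<open>auto simp: B_def\<close>)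
  have RA: "transpose_mat R * A' * R =
      four_block_mat (mat 1 1 (\<lambda>_. e)) (0\<^sub>m 1 n) (0\<^sub>m n 1) (transpose_mat Q * B * Q)"
    unfolding tR unfolding R_def A'b
    by (subst mult_four_block_mat[where ?n1.0=1 and ?n2.0=n and ?nr1.0=1 and ?nr2.0=n and ?nc1.0=1 and ?nc2.0=n],
        (insert Q B, auto)[6],
        subst mult_four_block_mat[where ?n1.0=1 and ?n2.0=n and ?nr1.0=1 and ?nr2.0=n and ?nc1.0=1 and ?nc2.0=n],
        (insert Q B, auto)[6], insert Q B, auto)
  define P where "P = W * R"
  have P: "P \<in> carrier_mat (Suc n) (Suc n)" using W R by (simp add: P_def)
  have tP: "transpose_mat P = transpose_mat R * transpose_mat W"
    unfolding P_def by (rule transpose_mult) (use W R in auto)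
  have tW: "transpose_mat W \<in> carrier_mat (Suc n) (Suc n)" "transpose_mat R \<in> carrier_mat (Suc n) (Suc n)"
    using W R by auto
  have "transpose_mat P * P = transpose_mat R * (transpose_mat W * W) * R"
    unfolding tP unfolding P_def using tW W(1) R
    by (simp add: assoc_mult_mat[of _ "Suc n" "Suc n" _ "Suc n" _ "Suc n"] mult_carrier_mat[of _ "Suc n" "Suc n" _ "Suc n"])
  also have "\<dots> = 1\<^sub>m (Suc n)"
    unfolding W(2) using tW RR by simp
  finally have PP: "transpose_mat P * P = 1\<^sub>m (Suc n)" .
  have "transpose_mat P * A * P = transpose_mat R * A' * R"
    unfolding tP unfolding P_def A'_def using tW W(1) R A
    by (simp add: assoc_mult_mat[of _ "Suc n" "Suc n" _ "Suc n" _ "Suc n"] mult_carrier_mat[of _ "Suc n" "Suc n" _ "Suc n"])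
  also have "\<dots> = mat (Suc n) (Suc n) (\<lambda>(i, j). if i = j then case_nat e es i else 0)"
    unfolding RA dQ by (rule eq_matI) (auto split: nat.splits)
  finally show ?case using P PP by blast
qed

lemma sum_set_conv_nth:
  assumes "distinct xs"
  shows "(\<Sum>a\<in>set xs. f a) = (\<Sum>k<length xs. f (xs ! k))"
  by (rule sum.reindex_bij_betw[symmetric, OF bij_betw_nth[OF assms refl refl]])

text \<open>The columns of the diagonalising matrix are read as functions on \<open>set xs\<close>.
  The last conclusion turns the root count in \<open>antiferromagnetic\<close> into signs of the
  \<open>l i\<close>; the eigenvector and norm equations serve the rescaled matrix in
  \<open>local_to_global\<close>.\<close>

lemma symmetric_form_spectral:
  fixes K :: "'i \<Rightarrow> 'i \<Rightarrow> real"
  assumes dist: "distinct xs" and sym: "\<And>a b. a \<in> set xs \<Longrightarrow> b \<in> set xs \<Longrightarrow> K a b = K b a"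
  obtains e :: "nat \<Rightarrow> 'i \<Rightarrow> real" and l :: "nat \<Rightarrow> real" where
    "\<And>i a. i < length xs \<Longrightarrow> a \<in> set xs \<Longrightarrow> (\<Sum>b\<in>set xs. K a b * e i b) = l i * e i a"
    "\<And>i. i < length xs \<Longrightarrow> (\<Sum>a\<in>set xs. (e i a)\<^sup>2) = 1"
    "\<And>u. (\<Sum>a\<in>set xs. \<Sum>b\<in>set xs. K a b * u a * u b) =
       (\<Sum>i<length xs. l i * (\<Sum>a\<in>set xs. u a * e i a)\<^sup>2)"
    "proots (char_poly (indexed_mat xs K)) = image_mset l (mset_set {..<length xs})"
proof -
  define n where "n = length xs"
  define A where "A = indexed_mat xs K"
  have A: "A \<in> carrier_mat n n" by (simp add: A_def indexed_mat_def n_def)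
  have Aij: "A $$ (i, j) = K (xs ! i) (xs ! j)" if "i < n" "j < n" for i j
    using that by (simp add: A_def indexed_mat_def n_def)
  have "transpose_mat A = A"
    by (rule eq_matI) (use A Aij sym in \<open>auto simp: n_def\<close>)
  then obtain P es where P: "P \<in> carrier_mat n n" "transpose_mat P * P = 1\<^sub>m n"
    and D: "transpose_mat P * A * P = mat n n (\<lambda>(i, j). if i = j then es i else 0)"
    using real_symmetric_diagonalization[OF A] by blast
  define D where "D = mat n n (\<lambda>(i, j). if i = j then es i else (0 :: real))"
  have Dc: "D \<in> carrier_mat n n" by (simp add: D_def)
  have tP: "transpose_mat P \<in> carrier_mat n n" using P by auto
  have PP: "P * transpose_mat P = 1\<^sub>m n"
    using mat_mult_left_right_inverse[OF tP P(1) P(2)] .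
  have "P * D = P * (transpose_mat P * (A * P))"
    using A P tP D by (simp add: D_def[symmetric] assoc_mult_mat[of _ n n _ n _ n])
  also have "\<dots> = P * transpose_mat P * (A * P)"
    by (rule assoc_mult_mat[symmetric]) (use A P tP in auto)
  also have "\<dots> = A * P" using A P by (simp add: PP)
  finally have PD: "A * P = P * D" ..
  have "A = A * (P * transpose_mat P)" using A by (simp add: PP)
  also have "\<dots> = A * P * transpose_mat P"
    by (rule assoc_mult_mat[symmetric]) (use A P tP in auto)
  finally have APD: "A = P * D * transpose_mat P" by (simp add: PD)
  have PDij: "(P * D) $$ (k, i) = P $$ (k, i) * es i" if "k < n" "i < n" for k i
    using that P by (simp add: D_def scalar_prod_def if_distrib cong: if_cong)
  define idx where "idx = inv_into {..<n} ((!) xs)"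
  have idx: "idx (xs ! k) = k" if "k < n" for k
    using dist that by (simp add: idx_def n_def inj_on_nth inv_into_f_f)
  define e where "e = (\<lambda>i a. P $$ (idx a, i))"
  have e: "e i (xs ! k) = P $$ (k, i)" if "k < n" for i k
    using idx[OF that] by (simp add: e_def)
  note S = sum_set_conv_nth[OF dist, folded n_def]
  show ?thesis
  proof (rule that[of e es, folded n_def])
    fix i a assume i: "i < n" and "a \<in> set xs"
    then obtain k where k: "k < n" "a = xs ! k" by (auto simp: in_set_conv_nth n_def)
    have "(\<Sum>b\<in>set xs. K a b * e i b) = (A * P) $$ (k, i)"
      using A P i k by (simp add: S e Aij scalar_prod_def atLeast0LessThan)
    then show "(\<Sum>b\<in>set xs. K a b * e i b) = es i * e i a"
      using i k by (simp add: PD PDij e)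
  next
    fix i assume i: "i < n"
    have "(\<Sum>a\<in>set xs. (e i a)\<^sup>2) = (transpose_mat P * P) $$ (i, i)"
      using P(1) i by (simp add: S e scalar_prod_def atLeast0LessThan power2_eq_square)
    then show "(\<Sum>a\<in>set xs. (e i a)\<^sup>2) = 1" using i by (simp add: P(2))
  next
    fix u :: "'i \<Rightarrow> real"
    have Aexp: "A $$ (k, l) = (\<Sum>i<n. es i * (P $$ (k, i) * P $$ (l, i)))" if "k < n" "l < n" for k l
    proof -
      have "A $$ (k, l) = row (P * D) k \<bullet> col (transpose_mat P) l"
        by (subst APD, rule index_mult_mat(1)) (use that P Dc in auto)
      also have "\<dots> = (\<Sum>i<n. row (P * D) k $ i * col (transpose_mat P) l $ i)"
        using P by (simp add: scalar_prod_def atLeast0LessThan)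
      also have "\<dots> = (\<Sum>i<n. (P * D) $$ (k, i) * P $$ (l, i))"
        by (intro sum.cong refl) (use that P Dc in \<open>simp add: index_row(1) index_col\<close>)
      finally have "A $$ (k, l) = (\<Sum>i<n. (P * D) $$ (k, i) * P $$ (l, i))" .
      then show ?thesis using that by (simp add: PDij mult_ac)
    qed
    have "(\<Sum>a\<in>set xs. \<Sum>b\<in>set xs. K a b * u a * u b) =
        (\<Sum>k<n. \<Sum>l<n. \<Sum>i<n. es i * (u (xs ! k) * P $$ (k, i)) * (u (xs ! l) * P $$ (l, i)))"
      unfolding S
      by (intro sum.cong refl) (simp add: Aij[symmetric] Aexp sum_distrib_left sum_distrib_right mult_ac)
    also have "\<dots> = (\<Sum>i<n. \<Sum>k<n. \<Sum>l<n. es i * (u (xs ! k) * P $$ (k, i)) * (u (xs ! l) * P $$ (l, i)))"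
      by (rule trans[OF sum.cong[OF refl sum.swap] sum.swap])
    also have "\<dots> = (\<Sum>i<n. es i * (\<Sum>a\<in>set xs. u a * e i a)\<^sup>2)"
      unfolding S
      by (intro sum.cong refl) (simp add: e power2_eq_square sum_product sum_distrib_left mult_ac)
    finally show "(\<Sum>a\<in>set xs. \<Sum>b\<in>set xs. K a b * u a * u b) =
        (\<Sum>i<n. es i * (\<Sum>a\<in>set xs. u a * e i a)\<^sup>2)" .
  next
    have "similar_mat A D"
      by (rule similar_matI[of _ _ P "transpose_mat P" n]) (use A Dc P tP PP APD in auto)
    then have "char_poly A = char_poly D" by (rule char_poly_similar)
    also have "\<dots> = (\<Prod>a\<leftarrow>diag_mat D. [:- a, 1:])"
      by (rule char_poly_upper_triangular[OF Dc]) (auto simp: D_def)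
    finally have "char_poly A = (\<Prod>a\<leftarrow>diag_mat D. [:- a, 1:])" .
    moreover have "proots (\<Prod>a\<leftarrow>as. [:- a, 1:]) = mset as" for as :: "real list"
    proof (induction as)
      case (Cons a as)
      have "(\<Prod>a\<leftarrow>as. [:- a, 1:]) \<noteq> 0" by (auto simp: prod_list_zero_iff)
      then have "proots ([:- a, 1:] * (\<Prod>a\<leftarrow>as. [:- a, 1:])) = {#a#} + mset as"
        by (subst proots_mult) (simp_all only: Cons.IH proots_linear_factor, simp_all)
      then show ?case by (simp only: list.map prod_list.Cons mset.simps add_mset_add_single[symmetric] add.commute)
    qed simp
    moreover have "diag_mat D = map es [0..<n]"
      by (auto simp: diag_mat_def D_def)
    then have "mset (diag_mat D) = image_mset es (mset_set {..<n})"
      by (simp add: atLeast0LessThan[symmetric])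
    ultimately show "proots (char_poly (indexed_mat xs K)) = image_mset es (mset_set {..<n})"
      by (simp add: A_def)
  qed
qed

section \<open>Forms with at most one positive eigenvalue\<close>

definition bform :: "'i set \<Rightarrow> ('i \<Rightarrow> 'i \<Rightarrow> real) \<Rightarrow> ('i \<Rightarrow> real) \<Rightarrow> ('i \<Rightarrow> real) \<Rightarrow> real" where
  "bform I B u v = (\<Sum>a\<in>I. \<Sum>b\<in>I. B a b * u a * v b)"

lemma bform_sym:
  assumes "\<And>a b. a \<in> I \<Longrightarrow> b \<in> I \<Longrightarrow> B a b = B b a"
  shows "bform I B u v = bform I B v u"
proof -
  have "bform I B u v = (\<Sum>b\<in>I. \<Sum>a\<in>I. B a b * u a * v b)"
    unfolding bform_def by (rule sum.swap)
  also have "\<dots> = bform I B v u"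
    unfolding bform_def by (intro sum.cong refl) (simp add: assms mult_ac)
  finally show ?thesis .
qed

lemma bform_diff_square:
  assumes "\<And>a b. a \<in> I \<Longrightarrow> b \<in> I \<Longrightarrow> B a b = B b a"
  shows "bform I B (\<lambda>a. u a - t * v a) (\<lambda>a. u a - t * v a) =
    bform I B u u - 2 * t * bform I B u v + t\<^sup>2 * bform I B v v"
proof -
  have "bform I B (\<lambda>a. u a - t * v a) (\<lambda>a. u a - t * v a) =
    bform I B u u - t * bform I B u v - t * bform I B v u + t\<^sup>2 * bform I B v v"
    unfolding bform_def sum_distrib_left sum_subtractf[symmetric] sum.distrib[symmetric]
    by (intro sum.cong refl) (simp add: algebra_simps power2_eq_square)
  moreover have "bform I B v u = bform I B u v"
    by (rule bform_sym) (rule assms)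
  ultimately show ?thesis by simp
qed

text \<open>If the form is positive at \<open>v\<close>, then \<open>v\<close> is off the hyperplane
  given by \<open>l\<close>, so u - t v lies on it for a suitable t, and there the form is
  nonpositive.\<close>

lemma reverse_cauchy_schwarz:
  assumes sym: "\<And>a b. a \<in> I \<Longrightarrow> b \<in> I \<Longrightarrow> B a b = B b a"
    and neg: "\<And>u. (\<Sum>a\<in>I. l a * u a) = 0 \<Longrightarrow> bform I B u u \<le> 0"
    and v: "bform I B v v \<ge> 0"
  shows "bform I B u u * bform I B v v \<le> (bform I B u v)\<^sup>2"
proof (cases "bform I B v v = 0")
  case False
  define L where "L u = (\<Sum>a\<in>I. l a * u a)" for u
  have Lv: "L v \<noteq> 0" using neg[of v] v False by (auto simp: L_def)
  define t where "t = L u / L v"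
  have "L (\<lambda>a. u a - t * v a) = L u - t * L v"
    by (simp add: L_def algebra_simps sum_subtractf sum_distrib_left)
  then have "L (\<lambda>a. u a - t * v a) = 0" using Lv by (simp add: t_def)
  then have "bform I B (\<lambda>a. u a - t * v a) (\<lambda>a. u a - t * v a) \<le> 0"
    unfolding L_def by (rule neg)
  moreover have "bform I B (\<lambda>a. u a - t * v a) (\<lambda>a. u a - t * v a) =
      bform I B u u - 2 * t * bform I B u v + t\<^sup>2 * bform I B v v"
    by (rule bform_diff_square) (rule sym)
  ultimately have "bform I B u u - 2 * t * bform I B u v + t\<^sup>2 * bform I B v v \<le> 0"
    by simp
  \<comment> \<open>Multiplied by \<open>bform I B v v\<close>, the quadratic in \<open>t\<close> is
    the difference of the two sides of the claim plus the square below.\<close>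
  then have "(bform I B u u - 2 * t * bform I B u v + t\<^sup>2 * bform I B v v) * bform I B v v \<le> 0"
    using v by (simp add: mult_nonpos_nonneg)
  moreover have "(bform I B u v - t * bform I B v v)\<^sup>2 \<ge> 0" by simp
  ultimately show ?thesis by (simp add: algebra_simps power2_eq_square)
qed simp

text \<open>The hyperplane is the orthogonal complement of the eigenvector for the only possible
  positive eigenvalue.\<close>

lemma antiferromagnetic_reverse_cauchy_schwarz:
  assumes M: "antiferromagnetic I M" and v: "bform I M v v \<ge> 0"
  shows "bform I M u u * bform I M v v \<le> (bform I M u v)\<^sup>2"
proof -
  have sym: "M a b = M b a" if "a \<in> I" "b \<in> I" for a b
    using M that by (auto simp: antiferromagnetic_def)
  obtain xs where xs: "distinct xs" "set xs = I"
    and size: "size (filter_mset (\<lambda>e. 0 < e) (proots (char_poly (indexed_mat xs M)))) \<le> 1"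
    using M by (auto simp: antiferromagnetic_def)
  obtain e l where
    "\<And>i a. i < length xs \<Longrightarrow> a \<in> I \<Longrightarrow> (\<Sum>b\<in>I. M a b * e i b) = l i * e i a"
    "\<And>i. i < length xs \<Longrightarrow> (\<Sum>a\<in>I. (e i a)\<^sup>2) = 1"
    and form: "\<And>u. (\<Sum>a\<in>I. \<Sum>b\<in>I. M a b * u a * u b) =
       (\<Sum>i<length xs. l i * (\<Sum>a\<in>I. u a * e i a)\<^sup>2)"
    and roots: "proots (char_poly (indexed_mat xs M)) = image_mset l (mset_set {..<length xs})"
    by (rule symmetric_form_spectral[of xs M, OF xs(1)], unfold xs(2)) (rule sym, assumption+, blast)
  have "card {i. i < length xs \<and> 0 < l i} \<le> 1"
    using size unfolding roots by (simp add: filter_mset_image_mset conj_commute)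
  \<comment> \<open>If no eigenvalue is positive, any \<open>k\<close> serves.\<close>
  then have "\<exists>k. \<forall>i. i < length xs \<and> 0 < l i \<longrightarrow> i = k"
    by (subst (asm) One_nat_def, subst (asm) card_le_Suc0_iff_eq) (simp, blast)
  then obtain k where k: "i = k" if "i < length xs" "0 < l i" for i by blast
  show ?thesis
  proof (rule reverse_cauchy_schwarz[OF sym _ v, where l = "e k"])
    fix u assume u: "(\<Sum>a\<in>I. e k a * u a) = 0"
    have "l i * (\<Sum>a\<in>I. u a * e i a)\<^sup>2 \<le> 0" if "i < length xs" for i
      using u k[OF that] by (cases "0 < l i") (auto simp: mult.commute mult_nonpos_nonneg)
    then show "bform I M u u \<le> 0"
      unfolding bform_def form by (auto intro!: sum_nonpos)
  qed
qed

text \<open>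
  Rescaling by \<open>r\<close> turns \<open>B\<close> into a symmetric matrix \<open>S\<close> with nonnegative entries and Perron eigenvalue
  \<open>1\<close>, and the hypothesis \<open>loc\<close> becomes \<open>S \<le> S\<^sup>2\<close>. Hence every positive eigenvalue of \<open>S\<close> is \<open>1\<close>, and
  by \<open>conn\<close> this eigenvalue is simple. Indices with \<open>s a = 0\<close> have a zero row in \<open>B\<close>, so that
  \<open>r a = 0\<close> there is harmless.
\<close>

lemma local_to_global:
  fixes T :: "'i \<Rightarrow> 'i \<Rightarrow> 'i \<Rightarrow> real" and w :: "'i \<Rightarrow> real"
  assumes I: "finite I"
    and T1: "\<And>a b c. a \<in> I \<Longrightarrow> b \<in> I \<Longrightarrow> c \<in> I \<Longrightarrow> T a b c = T b a c"
    and T2: "\<And>a b c. a \<in> I \<Longrightarrow> b \<in> I \<Longrightarrow> c \<in> I \<Longrightarrow> T a b c = T a c b"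
    and T0: "\<And>a b c. a \<in> I \<Longrightarrow> b \<in> I \<Longrightarrow> c \<in> I \<Longrightarrow> T a b c \<ge> 0"
    and w: "\<And>a. a \<in> I \<Longrightarrow> w a > 0"
    and loc: "\<And>a u. a \<in> I \<Longrightarrow> bform I (T a) u u * bform I (T a) w w \<le> (bform I (T a) u w)\<^sup>2"
    and B: "\<And>a b. B a b = (\<Sum>c\<in>I. w c * T c a b)"
    and conn: "\<And>f a b. \<lbrakk>\<And>x y. x \<in> I \<Longrightarrow> y \<in> I \<Longrightarrow> B x y > 0 \<Longrightarrow> f x = f y; a \<in> I; b \<in> I;
        \<exists>x\<in>I. B a x > 0; \<exists>x\<in>I. B b x > 0\<rbrakk> \<Longrightarrow> (f a :: real) = f b"
    and v: "bform I B v v \<ge> 0"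
  shows "bform I B u u * bform I B v v \<le> (bform I B u v)\<^sup>2"
proof -
  define s where "s a = (\<Sum>b\<in>I. B a b * w b)" for a
  define r where "r a = sqrt (w a / s a)" for a
  define S where "S a b = r a * B a b * r b" for a b
  have w0: "w a \<ge> 0" if "a \<in> I" for a
    using w[OF that] by simp
  have B0: "B a b \<ge> 0" if "a \<in> I" "b \<in> I" for a b
    unfolding B using that by (intro sum_nonneg mult_nonneg_nonneg T0 w0)
  have symB: "B a b = B b a" if "a \<in> I" "b \<in> I" for a b
    unfolding B using that by (intro sum.cong refl) (simp add: T2)
  have s0: "s a \<ge> 0" if "a \<in> I" for a
    unfolding s_def using that by (intro sum_nonneg mult_nonneg_nonneg B0 w0)
  have row: "B a b = 0" if "a \<in> I" "b \<in> I" "s a = 0" for a b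
  proof -
    have "B a b * w b = 0"
      using that(3) unfolding s_def
      by (subst (asm) sum_nonneg_eq_0_iff[OF I]) (use that in \<open>auto intro!: mult_nonneg_nonneg B0 w0\<close>)
    then show ?thesis using w[OF that(2)] by simp
  qed
  \<comment> \<open>Pairing the form \<open>T a\<close> with \<open>w\<close> gives the row of
    \<open>B\<close> at \<open>a\<close>; in particular \<open>bform I (T a) w w\<close> is
    \<open>s a\<close>.\<close>
  have Tw: "bform I (T a) u w = (\<Sum>b\<in>I. B a b * u b)" if "a \<in> I" for a u
  proof -
    have "bform I (T a) u w = (\<Sum>b\<in>I. \<Sum>c\<in>I. w c * T c a b * u b)"
      unfolding bform_def using that by (intro sum.cong refl) (simp add: T1[of _ a] T2[of a])
    then show ?thesis by (simp add: B sum_distrib_right)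
  qed
  have rowT: "T a b c = 0" if "a \<in> I" "b \<in> I" "c \<in> I" "s a = 0" for a b c
  proof -
    have "w c * T c a b = 0"
      using row[OF that(1,2,4)] unfolding B
      by (subst (asm) sum_nonneg_eq_0_iff[OF I]) (use that in \<open>auto intro!: mult_nonneg_nonneg T0 w0\<close>)
    then show ?thesis using w[OF that(3)] that T1 T2 by simp
  qed
  have BT: "bform I B u u = (\<Sum>c\<in>I. w c * bform I (T c) u u)" for u
  proof -
    have "bform I B u u = (\<Sum>a\<in>I. \<Sum>b\<in>I. \<Sum>c\<in>I. w c * (T c a b * u a * u b))"
      unfolding bform_def B by (simp add: sum_distrib_left sum_distrib_right mult_ac)
    also have "\<dots> = (\<Sum>a\<in>I. \<Sum>c\<in>I. \<Sum>b\<in>I. w c * (T c a b * u a * u b))"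
      by (rule sum.cong[OF refl sum.swap])
    also have "\<dots> = (\<Sum>c\<in>I. \<Sum>a\<in>I. \<Sum>b\<in>I. w c * (T c a b * u a * u b))"
      by (rule sum.swap)
    finally show ?thesis by (simp add: bform_def sum_distrib_left)
  qed
  \<comment> \<open>This is S <= S^2 before rescaling: the local inequality at \<open>a\<close>,
    divided by \<open>s a\<close>, multiplied by \<open>w a\<close> and summed.\<close>
  have BM: "bform I B u u \<le> (\<Sum>a\<in>I. (r a * (\<Sum>b\<in>I. B a b * u b))\<^sup>2)" for u
    unfolding BT
  proof (rule sum_mono)
    fix a assume a: "a \<in> I"
    show "w a * bform I (T a) u u \<le> (r a * (\<Sum>b\<in>I. B a b * u b))\<^sup>2"
    proof (cases "s a = 0")
      case True
      then have "bform I (T a) u u = 0"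
        unfolding bform_def using rowT a by (auto intro!: sum.neutral)
      then show ?thesis by simp
    next
      case False
      then have sa: "s a > 0" using s0[OF a] by simp
      have "bform I (T a) u u * s a \<le> (\<Sum>b\<in>I. B a b * u b)\<^sup>2"
        using loc[OF a, of u] unfolding Tw[OF a] s_def .
      then have "bform I (T a) u u \<le> (\<Sum>b\<in>I. B a b * u b)\<^sup>2 / s a"
        using sa by (simp add: pos_le_divide_eq)
      then have "w a * bform I (T a) u u \<le> w a * ((\<Sum>b\<in>I. B a b * u b)\<^sup>2 / s a)"
        by (rule mult_left_mono) (rule w0[OF a])
      also have "\<dots> = (r a * (\<Sum>b\<in>I. B a b * u b))\<^sup>2"
        using w[OF a] sa by (simp add: r_def power_mult_distrib)
      finally show ?thesis .
    qed
  qed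
  obtain xs where xs: "set xs = I" "distinct xs" using finite_distinct_list[OF I] by auto
  have symS: "S a b = S b a" if "a \<in> I" "b \<in> I" for a b
    using symB[OF that] by (simp add: S_def)
  obtain e l where eig: "\<And>i a. i < length xs \<Longrightarrow> a \<in> I \<Longrightarrow> (\<Sum>b\<in>I. S a b * e i b) = l i * e i a"
    and norm: "\<And>i. i < length xs \<Longrightarrow> (\<Sum>a\<in>I. (e i a)\<^sup>2) = 1"
    and form: "\<And>u. (\<Sum>a\<in>I. \<Sum>b\<in>I. S a b * u a * u b) =
       (\<Sum>i<length xs. l i * (\<Sum>a\<in>I. u a * e i a)\<^sup>2)"
    by (rule symmetric_form_spectral[of xs S, OF xs(2)], unfold xs(1)) (rule symS, assumption+, blast)
  \<comment> \<open>Eigenvectors of positive eigenvalue all become, after scaling by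
    \<open>r\<close>, multiples of the one vector \<open>w\<close> where \<open>s a > 0\<close>, so
    a single linear condition annihilates them together.\<close>
  have ker: "\<exists>k. \<forall>a\<in>I. s a > 0 \<longrightarrow> r a * e i a = k * w a" if i: "i < length xs" and li: "l i > 0" for i
  proof -
    define y where "y a = r a * e i a" for a
    define f where "f a = y a / w a" for a
    have By: "r a * (\<Sum>b\<in>I. B a b * y b) = l i * e i a" if "a \<in> I" for a
      using eig[OF i that] by (simp add: S_def y_def sum_distrib_left mult_ac)
    have "bform I B y y = (\<Sum>a\<in>I. e i a * (r a * (\<Sum>b\<in>I. B a b * y b)))"
      by (simp add: bform_def sum_distrib_left y_def mult_ac)
    also have "\<dots> = (\<Sum>a\<in>I. e i a * (l i * e i a))"
      by (intro sum.cong refl) (simp add: By)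
    also have "\<dots> = l i * (\<Sum>a\<in>I. (e i a)\<^sup>2)"
      by (simp add: sum_distrib_left power2_eq_square mult_ac)
    finally have Byy: "bform I B y y = l i" using norm[OF i] by simp
    have "bform I B y y \<le> (\<Sum>a\<in>I. (l i * e i a)\<^sup>2)"
      using BM[of y] by (simp add: By)
    also have "\<dots> = (l i)\<^sup>2"
      using norm[OF i] by (simp add: power_mult_distrib sum_distrib_left[symmetric])
    finally have "l i * 1 \<le> l i * l i" unfolding Byy by (simp add: power2_eq_square)
    then have l1: "l i \<ge> 1" using li by (simp only: mult_le_cancel_left_pos)
    \<comment> \<open>Summed over \<open>a\<close> and \<open>b\<close> this is the Dirichlet energy
      of \<open>f\<close>. It is at most 2 (1 - l i), hence zero by \<open>l1\<close>, and
      \<open>f\<close> is constant along every positive entry of \<open>B\<close>.\<close>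
    have sw: "B a b * w a * w b * (f a - f b)\<^sup>2 =
        B a b * w b * ((y a)\<^sup>2 / w a) + B b a * w a * ((y b)\<^sup>2 / w b) - 2 * (B a b * y a * y b)"
      if "a \<in> I" "b \<in> I" for a b
      using w[OF that(1)] w[OF that(2)] symB[OF that]
      by (simp add: f_def field_simps power2_eq_square)
    have "(\<Sum>a\<in>I. \<Sum>b\<in>I. B a b * w a * w b * (f a - f b)\<^sup>2) =
        (\<Sum>a\<in>I. \<Sum>b\<in>I. B a b * w b * ((y a)\<^sup>2 / w a)) + (\<Sum>a\<in>I. \<Sum>b\<in>I. B b a * w a * ((y b)\<^sup>2 / w b))
          - 2 * bform I B y y"
      unfolding bform_def sum_distrib_left sum_subtractf[symmetric] sum.distrib[symmetric]
      by (intro sum.cong refl) (simp add: sw)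
    also have "(\<Sum>a\<in>I. \<Sum>b\<in>I. B b a * w a * ((y b)\<^sup>2 / w b)) = (\<Sum>a\<in>I. \<Sum>b\<in>I. B a b * w b * ((y a)\<^sup>2 / w a))"
      by (rule sum.swap)
    also have "(\<Sum>a\<in>I. \<Sum>b\<in>I. B a b * w b * ((y a)\<^sup>2 / w a)) = (\<Sum>a\<in>I. s a * ((y a)\<^sup>2 / w a))"
      by (simp add: s_def sum_distrib_right sum_divide_distrib)
    finally have energy: "(\<Sum>a\<in>I. \<Sum>b\<in>I. B a b * w a * w b * (f a - f b)\<^sup>2) =
        (\<Sum>a\<in>I. s a * ((y a)\<^sup>2 / w a)) + (\<Sum>a\<in>I. s a * ((y a)\<^sup>2 / w a)) - 2 * bform I B y y" .
    have "(\<Sum>a\<in>I. s a * ((y a)\<^sup>2 / w a)) \<le> (\<Sum>a\<in>I. (e i a)\<^sup>2)"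
    proof (rule sum_mono)
      fix a assume a: "a \<in> I"
      show "s a * ((y a)\<^sup>2 / w a) \<le> (e i a)\<^sup>2"
        using w[OF a] s0[OF a] by (cases "s a = 0") (simp_all add: y_def r_def power_mult_distrib)
    qed
    then have "(\<Sum>a\<in>I. \<Sum>b\<in>I. B a b * w a * w b * (f a - f b)\<^sup>2) \<le> 0"
      unfolding energy using Byy norm[OF i] l1 by simp
    moreover have pos: "B a b * w a * w b * (f a - f b)\<^sup>2 \<ge> 0" if "a \<in> I" "b \<in> I" for a b
      using that B0 w by (simp add: less_imp_le)
    ultimately have "(\<Sum>a\<in>I. \<Sum>b\<in>I. B a b * w a * w b * (f a - f b)\<^sup>2) = 0"
      by (meson antisym sum_nonneg)
    then have "B a b * w a * w b * (f a - f b)\<^sup>2 = 0" if "a \<in> I" "b \<in> I" for a b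
      using that pos I by (simp add: sum_nonneg_eq_0_iff sum_nonneg)
    then have fB: "f a = f b" if "a \<in> I" "b \<in> I" "B a b > 0" for a b
      using that w[of a] w[of b] by force
    have nb: "\<exists>x\<in>I. B a x > 0" if "a \<in> I" "s a > 0" for a
    proof (rule ccontr)
      assume "\<not> ?thesis"
      then have "B a x = 0" if "x \<in> I" for x using B0[OF \<open>a \<in> I\<close> that] that by force
      then show False using that by (simp add: s_def)
    qed
    show ?thesis
    proof (cases "\<exists>a\<in>I. s a > 0")
      case True
      then obtain a0 where a0: "a0 \<in> I" "s a0 > 0" by auto
      have "f a = f a0" if "a \<in> I" "s a > 0" for a
        by (rule conn[of f]) (use fB that a0 nb in auto)
      then have "r a * e i a = f a0 * w a" if "a \<in> I" "s a > 0" for a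
        using that w[of a] unfolding y_def[symmetric] by (force simp: f_def field_simps)
      then show ?thesis by blast
    qed auto
  qed
  \<comment> \<open>Since \<open>s\<close> is \<open>B\<close> applied to \<open>w\<close>, the
    hyperplane used here is the \<open>B\<close>-orthogonal complement of \<open>w\<close>.\<close>
  show ?thesis
  proof (rule reverse_cauchy_schwarz[OF symB _ v, where l = s])
    fix u assume u: "(\<Sum>a\<in>I. s a * u a) = 0"
    define x where "x a = u a / r a" for a
    have r0: "r a \<noteq> 0" if "a \<in> I" "s a \<noteq> 0" for a
      using w[OF that(1)] that(2) by (simp add: r_def)
    have "bform I B u u = (\<Sum>a\<in>I. \<Sum>b\<in>I. S a b * x a * x b)"
      unfolding bform_def
    proof (intro sum.cong refl)
      fix a b assume ab: "a \<in> I" "b \<in> I"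
      show "B a b * u a * u b = S a b * x a * x b"
      proof (cases "s a = 0 \<or> s b = 0")
        case True
        then have "B a b = 0" using row ab symB by metis
        then show ?thesis by (simp add: S_def)
      qed (use r0 ab in \<open>simp add: S_def x_def\<close>)
    qed
    also have "\<dots> \<le> 0"
      unfolding form
    proof (rule sum_nonpos)
      fix i assume "i \<in> {..<length xs}"
      then have i: "i < length xs" by simp
      show "l i * (\<Sum>a\<in>I. x a * e i a)\<^sup>2 \<le> 0"
      proof (cases "l i > 0")
        case True
        obtain k where k: "\<And>a. a \<in> I \<Longrightarrow> s a > 0 \<Longrightarrow> r a * e i a = k * w a"
          using ker[OF i True] by blast
        \<comment> \<open>Because r^2 = w / s, dividing \<open>u\<close> by \<open>r\<close> turns
          orthogonality to the eigenvector into the hyperplane condition on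
          \<open>u\<close>.\<close>
        have "x a * e i a = k * (s a * u a)" if a: "a \<in> I" for a
        proof (cases "s a = 0")
          case True
          then show ?thesis by (simp add: x_def r_def)
        next
          case False
          then have sa: "s a > 0" using s0[OF a] by simp
          have rr: "r a * r a = w a / s a" using sa w[OF a] by (simp add: r_def)
          have "x a * e i a = u a * (r a * e i a) / (r a * r a)"
            using r0[OF a False] by (simp add: x_def)
          then show ?thesis using k[OF a sa] sa w[OF a] by (simp add: rr)
        qed
        then show ?thesis using u by (simp add: sum_distrib_left[symmetric])
      qed (simp add: mult_nonpos_nonneg)
    qed
    finally show "bform I B u u \<le> 0" .
  qed
qed

section \<open>The Alexandrov-Fenchel inequality\<close>

text \<open>
  A homogeneous polynomial \<open>f\<close> of degree \<open>d\<close> is represented by the function that sends a multiset \<open>M\<close>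
  of \<open>d\<close> variables to the iterated partial derivative of \<open>f\<close> along \<open>M\<close>. Then
  \<open>dderiv A w\<close> is the derivative in direction \<open>w\<close>, and evaluating at \<open>{#}\<close> after \<open>d\<close> of them gives the
  polar form of \<open>f\<close>, up to the factor \<open>d!\<close>.
\<close>

definition dderiv :: "'a set \<Rightarrow> ('a \<Rightarrow> real) \<Rightarrow> ('a multiset \<Rightarrow> real) \<Rightarrow> 'a multiset \<Rightarrow> real" where
  "dderiv A w q M = (\<Sum>a\<in>A. w a * q (add_mset a M))"

definition dderivs :: "'a set \<Rightarrow> ('a \<Rightarrow> real) list \<Rightarrow> ('a multiset \<Rightarrow> real) \<Rightarrow> 'a multiset \<Rightarrow> real" where
  "dderivs A ws q = foldr (dderiv A) ws q"

text \<open>The partial derivative along \<open>a\<close>; for the weights of a law it is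
  conditioning on one coordinate being \<open>a\<close>, without renormalisation.\<close>

definition shift :: "'a \<Rightarrow> ('a multiset \<Rightarrow> real) \<Rightarrow> 'a multiset \<Rightarrow> real" where
  "shift a q M = q (add_mset a M)"

lemma dderivs_Nil [simp]: "dderivs A [] q = q"
  and dderivs_Cons [simp]: "dderivs A (w # ws) q = dderiv A w (dderivs A ws q)"
  by (simp_all add: dderivs_def)

lemma dderiv_commute: "dderiv A u (dderiv A v q) = dderiv A v (dderiv A u q)"
  unfolding dderiv_def sum_distrib_left
  by (rule ext, subst sum.swap) (simp add: add_mset_commute mult.left_commute)

lemma dderivs_dderiv: "dderivs A ws (dderiv A u q) = dderiv A u (dderivs A ws q)"
  by (induction ws) (simp_all add: dderiv_commute)

lemma dderiv_shift: "dderiv A w (shift a q) = shift a (dderiv A w q)"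
  by (simp add: fun_eq_iff dderiv_def shift_def add_mset_commute)

lemma dderivs_shift: "dderivs A ws (shift a q) = shift a (dderivs A ws q)"
  by (induction ws) (simp_all add: dderiv_shift)

lemma dderiv_scale: "dderiv A w (\<lambda>M. c * q M) = (\<lambda>M. c * dderiv A w q M)"
  by (simp add: fun_eq_iff dderiv_def sum_distrib_left mult.left_commute)

lemma dderivs_scale: "dderivs A ws (\<lambda>M. c * q M) = (\<lambda>M. c * dderivs A ws q M)"
  by (induction ws) (simp_all add: dderiv_scale)

lemma dderiv_nonneg:
  assumes "\<And>M. 0 \<le> q M" "\<And>a. a \<in> A \<Longrightarrow> 0 \<le> w a"
  shows "0 \<le> dderiv A w q M"
  unfolding dderiv_def using assms by (auto intro!: sum_nonneg)

lemma dderivs_nonneg: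
  assumes "\<And>M. 0 \<le> q M" "\<And>w a. w \<in> set ws \<Longrightarrow> a \<in> A \<Longrightarrow> 0 \<le> w a"
  shows "0 \<le> dderivs A ws q M"
  using assms(2) by (induction ws arbitrary: M) (auto intro!: dderiv_nonneg assms(1))

lemma dderiv_dderiv_empty: "dderiv A u (dderiv A v r) {#} = bform A (\<lambda>a b. r {#a, b#}) u v"
  unfolding dderiv_def bform_def sum_distrib_left
  by (intro sum.cong refl) (simp add: add_mset_commute mult_ac)

text \<open>The direction \<open>u\<close> may have any sign because the local hypothesis of
  \<open>local_to_global\<close> ranges over all vectors. For m < 2 the statement is
  vacuous.\<close>

definition alexandrov_fenchel :: "'a set \<Rightarrow> nat \<Rightarrow> ('a multiset \<Rightarrow> real) \<Rightarrow> bool" where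
  "alexandrov_fenchel A m q \<longleftrightarrow>
     (\<forall>ws u v. length ws + 2 = m \<longrightarrow> (\<forall>w\<in>set ws. \<forall>a\<in>A. 0 \<le> w a) \<longrightarrow> (\<forall>a\<in>A. 0 \<le> v a) \<longrightarrow>
        dderiv A u (dderiv A u (dderivs A ws q)) {#} * dderiv A v (dderiv A v (dderivs A ws q)) {#}
          \<le> (dderiv A u (dderiv A v (dderivs A ws q)) {#})\<^sup>2)"

lemma alexandrov_fenchelD:
  assumes "alexandrov_fenchel A m q" "length ws + 2 = m"
    "\<And>w a. w \<in> set ws \<Longrightarrow> a \<in> A \<Longrightarrow> 0 \<le> w a" "\<And>a. a \<in> A \<Longrightarrow> 0 \<le> v a"
  shows "dderiv A u (dderiv A u (dderivs A ws q)) {#} * dderiv A v (dderiv A v (dderivs A ws q)) {#}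
          \<le> (dderiv A u (dderiv A v (dderivs A ws q)) {#})\<^sup>2"
  using assms unfolding alexandrov_fenchel_def by blast

lemma alexandrov_fenchel_scale:
  assumes "alexandrov_fenchel A m q"
  shows "alexandrov_fenchel A m (\<lambda>M. c * q M)"
  unfolding alexandrov_fenchel_def dderivs_scale dderiv_scale
proof (intro allI impI)
  fix ws :: "('a \<Rightarrow> real) list" and u v :: "'a \<Rightarrow> real"
  assume "length ws + 2 = m" "\<forall>w\<in>set ws. \<forall>a\<in>A. 0 \<le> w a" "\<forall>a\<in>A. 0 \<le> v a"
  then have "dderiv A u (dderiv A u (dderivs A ws q)) {#} * dderiv A v (dderiv A v (dderivs A ws q)) {#}
          \<le> (dderiv A u (dderiv A v (dderivs A ws q)) {#})\<^sup>2" (is "?x * ?y \<le> ?z\<^sup>2")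
    by (intro alexandrov_fenchelD[OF assms]) auto
  then have "c\<^sup>2 * (?x * ?y) \<le> c\<^sup>2 * ?z\<^sup>2" by (intro mult_left_mono) auto
  then show "c * ?x * (c * ?y) \<le> (c * ?z)\<^sup>2" by (simp add: power2_eq_square mult_ac)
qed

lemma alexandrov_fenchel_dderiv:
  assumes "alexandrov_fenchel A (Suc m) q" "m \<ge> 2" "\<And>a. a \<in> A \<Longrightarrow> 0 \<le> w a"
  shows "alexandrov_fenchel A m (dderiv A w q)"
  unfolding alexandrov_fenchel_def
proof (intro allI impI)
  fix ws :: "('a \<Rightarrow> real) list" and u v :: "'a \<Rightarrow> real"
  assume "length ws + 2 = m" "\<forall>w\<in>set ws. \<forall>a\<in>A. 0 \<le> w a" "\<forall>a\<in>A. 0 \<le> v a"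
  then show "dderiv A u (dderiv A u (dderivs A ws (dderiv A w q))) {#} *
      dderiv A v (dderiv A v (dderivs A ws (dderiv A w q))) {#}
          \<le> (dderiv A u (dderiv A v (dderivs A ws (dderiv A w q))) {#})\<^sup>2"
    using alexandrov_fenchelD[OF assms(1), of "w # ws" v u] assms(3)
    by (auto simp: dderivs_dderiv)
qed

lemma alexandrov_fenchel_shift:
  assumes "finite A" "alexandrov_fenchel A (Suc m) q" "m \<ge> 2" "a \<in> A"
  shows "alexandrov_fenchel A m (shift a q)"
proof -
  have "shift a q = dderiv A (\<lambda>b. if b = a then 1 else 0) q"
    using assms(1,4) by (simp add: fun_eq_iff shift_def dderiv_def if_distrib[of "\<lambda>x. x * _"] cong: if_cong)
  then show ?thesis using alexandrov_fenchel_dderiv[OF assms(2,3)] by simp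
qed

text \<open>Along strictly positive directions nothing cancels or is lost, so the sign of an
  iterated derivative depends only on the support. This lets M-convexity, a statement about
  supports, decide connectivity.\<close>

lemma dderivs_pos_iff:
  assumes A: "finite A" and q: "\<And>M. 0 \<le> q M" and ws: "\<And>w a. w \<in> set ws \<Longrightarrow> a \<in> A \<Longrightarrow> 0 < w a"
  shows "dderivs A ws q M > 0 \<longleftrightarrow> (\<exists>N. set_mset N \<subseteq> A \<and> size N = length ws \<and> q (M + N) > 0)"
  using ws
proof (induction ws arbitrary: M)
  case (Cons w ws)
  let ?r = "dderivs A ws q"
  have r: "0 \<le> ?r M" for M
    using Cons.prems by (intro dderivs_nonneg q) (auto intro: less_imp_le)
  have w: "0 < w a" if "a \<in> A" for a using Cons.prems that by auto
  have "dderiv A w ?r M > 0 \<longleftrightarrow> (\<exists>a\<in>A. ?r (add_mset a M) > 0)"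
  proof
    assume "dderiv A w ?r M > 0"
    then obtain a where "a \<in> A" "w a * ?r (add_mset a M) \<noteq> 0"
      unfolding dderiv_def by (metis (no_types, lifting) less_irrefl sum.neutral)
    then show "\<exists>a\<in>A. ?r (add_mset a M) > 0" using r by (force simp: order_less_le)
  next
    assume "\<exists>a\<in>A. ?r (add_mset a M) > 0"
    then obtain a where a: "a \<in> A" "?r (add_mset a M) > 0" by auto
    show "dderiv A w ?r M > 0"
      unfolding dderiv_def
      by (rule sum_pos2[OF A a(1)]) (use a w r in \<open>auto intro!: mult_nonneg_nonneg less_imp_le[of 0 "w _"]\<close>)
  qed
  also have "\<dots> \<longleftrightarrow> (\<exists>a\<in>A. \<exists>N. set_mset N \<subseteq> A \<and> size N = length ws \<and> q (add_mset a M + N) > 0)"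
    using Cons by simp
  also have "\<dots> \<longleftrightarrow> (\<exists>N. set_mset N \<subseteq> A \<and> size N = length (w # ws) \<and> q (M + N) > 0)"
  proof (intro iffI; elim bexE exE conjE)
    fix a N assume "a \<in> A" "set_mset N \<subseteq> A" "size N = length ws" "0 < q (add_mset a M + N)"
    then show "\<exists>N. set_mset N \<subseteq> A \<and> size N = length (w # ws) \<and> q (M + N) > 0"
      by (intro exI[of _ "add_mset a N"]) auto
  next
    fix N assume N: "set_mset N \<subseteq> A" "size N = length (w # ws)" "0 < q (M + N)"
    then obtain a N' where "N = add_mset a N'" by (cases N) auto
    then show "\<exists>a\<in>A. \<exists>N. set_mset N \<subseteq> A \<and> size N = length ws \<and> q (add_mset a M + N) > 0"
      using N by auto
  qed
  finally show ?case by simp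
qed auto

lemma tendsto_dderivs_perturb:
  "((\<lambda>\<epsilon>. dderivs A (map (\<lambda>w a. w a + \<epsilon>) ws) q M) \<longlongrightarrow> dderivs A ws q M) (at_right 0)"
proof (induction ws arbitrary: M)
  case (Cons w ws)
  have "((\<lambda>\<epsilon>. \<Sum>a\<in>A. (w a + \<epsilon>) * dderivs A (map (\<lambda>w a. w a + \<epsilon>) ws) q (add_mset a M)) \<longlongrightarrow>
     (\<Sum>a\<in>A. (w a + 0) * dderivs A ws q (add_mset a M))) (at_right 0)"
    by (intro tendsto_intros Cons.IH)
  then show ?case by (simp add: dderiv_def)
qed simp

text \<open>\<open>exch\<close> is one side of the M-convex exchange, for an element absent from
  \<open>N\<close>. The first direction of \<open>ws\<close> becomes \<open>w\<close> in
  \<open>local_to_global\<close>, and the others are absorbed into the tensor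
  \<open>T\<close>.\<close>

lemma alexandrov_fenchel_step:
  assumes A: "finite A" and q: "\<And>M. 0 \<le> q M" and m: "m \<ge> 2"
    and loc: "\<And>a. a \<in> A \<Longrightarrow> alexandrov_fenchel A m (shift a q)"
    and exch: "\<And>M N \<sigma>. \<lbrakk>set_mset M \<subseteq> A; set_mset N \<subseteq> A; size M = Suc m; size N = Suc m;
        q M > 0; q N > 0; \<sigma> \<in># M; \<sigma> \<notin># N\<rbrakk> \<Longrightarrow> \<exists>\<tau>\<in>#N. q (add_mset \<tau> (M - {#\<sigma>#})) > 0"
  shows "alexandrov_fenchel A (Suc m) q"
proof -
  have pos: "dderiv A u (dderiv A u (dderivs A ws q)) {#} * dderiv A v (dderiv A v (dderivs A ws q)) {#}
          \<le> (dderiv A u (dderiv A v (dderivs A ws q)) {#})\<^sup>2"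
    if len: "length ws + 2 = Suc m" and ws: "\<And>w a. w \<in> set ws \<Longrightarrow> a \<in> A \<Longrightarrow> 0 < w a"
      and v: "\<And>a. a \<in> A \<Longrightarrow> 0 \<le> v a" for ws u v
  proof -
    obtain w ws' where wws: "ws = w # ws'" using len m by (cases ws) auto
    define r where "r = dderivs A ws' q"
    define B where "B a b = dderiv A w r {#a, b#}" for a b
    have r0: "0 \<le> r M" for M
      unfolding r_def using ws by (intro dderivs_nonneg q) (auto simp: wws intro: less_imp_le)
    have w: "0 < w a" if "a \<in> A" for a using ws that by (simp add: wws)
    have "bform A B u u * bform A B v v \<le> (bform A B u v)\<^sup>2"
    proof (rule local_to_global[where T = "\<lambda>a b c. r {#a, b, c#}" and w = w, OF A])
      fix a u assume a: "a \<in> A"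
      have "dderiv A u (dderiv A u (dderivs A ws' (shift a q))) {#} * dderiv A w (dderiv A w (dderivs A ws' (shift a q))) {#}
          \<le> (dderiv A u (dderiv A w (dderivs A ws' (shift a q))) {#})\<^sup>2"
        by (rule alexandrov_fenchelD[OF loc[OF a]]) (use len ws wws w in \<open>auto intro: less_imp_le\<close>)
      then show "bform A (\<lambda>b c. r {#a, b, c#}) u u * bform A (\<lambda>b c. r {#a, b, c#}) w w
          \<le> (bform A (\<lambda>b c. r {#a, b, c#}) u w)\<^sup>2"
        by (simp add: dderiv_dderiv_empty dderivs_shift r_def shift_def)
    next
      fix a b show "B a b = (\<Sum>c\<in>A. w c * r {#c, a, b#})"
        by (simp add: B_def dderiv_def)
    next
      fix f :: "'a \<Rightarrow> real" and a b
      assume f: "\<And>x y. x \<in> A \<Longrightarrow> y \<in> A \<Longrightarrow> B x y > 0 \<Longrightarrow> f x = f y"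
        and ab: "a \<in> A" "b \<in> A" "\<exists>x\<in>A. B a x > 0" "\<exists>x\<in>A. B b x > 0"
      have Bpos: "B x y > 0 \<longleftrightarrow> (\<exists>N. set_mset N \<subseteq> A \<and> size N = length ws \<and> q ({#x, y#} + N) > 0)" for x y
      proof -
        have "dderivs A ws q {#x, y#} > 0 \<longleftrightarrow>
            (\<exists>N. set_mset N \<subseteq> A \<and> size N = length ws \<and> q ({#x, y#} + N) > 0)"
          by (rule dderivs_pos_iff[OF A q]) (rule ws)
        then show ?thesis by (simp add: B_def r_def wws)
      qed
      \<comment> \<open>Two distinct elements of a support monomial give a positive entry of
        \<open>B\<close>, so \<open>f\<close> is constant on each such monomial.\<close>
      have const: "f c = f d"
        if M: "set_mset M \<subseteq> A" "size M = Suc m" "q M > 0" and cd: "c \<in># M" "d \<in># M" for M c d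
      proof (cases "c = d")
        case False
        obtain M' where M': "M = add_mset c M'"
          using cd(1) by (blast dest: multi_member_split)
        then have "d \<in># M'" using cd(2) False by auto
        then obtain N where "M' = add_mset d N"
          by (blast dest: multi_member_split)
        then have N: "M = {#c, d#} + N" using M' by simp
        then have "B c d > 0" unfolding Bpos using M len by (intro exI[of _ N]) auto
        then show ?thesis using f M cd by auto
      qed simp
      have ex: "\<exists>M x. set_mset M \<subseteq> A \<and> size M = Suc m \<and> q M > 0 \<and> {#a, x#} \<subseteq># M" if ax: "a \<in> A" "\<exists>x\<in>A. B a x > 0" for a
      proof -
        obtain x N where "x \<in> A" "set_mset N \<subseteq> A" "size N = length ws" "q ({#a, x#} + N) > 0"
          using ax unfolding Bpos by auto
        then show ?thesis using ax len by (intro exI[of _ "{#a, x#} + N"] exI[of _ x]) auto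
      qed
      obtain M x where M: "set_mset M \<subseteq> A" "size M = Suc m" "q M > 0" "{#a, x#} \<subseteq># M"
        using ex[OF ab(1,3)] by blast
      obtain N y where N: "set_mset N \<subseteq> A" "size N = Suc m" "q N > 0" "{#b, y#} \<subseteq># N"
        using ex[OF ab(2,4)] by blast
      have aM: "a \<in># M" and xM: "x \<in># M" and xM': "x \<in># M - {#a#}" and bN: "b \<in># N"
        using M(4) N(4) by (auto simp: insert_subset_eq_iff dest: in_diffD)
      show "f a = f b"
      proof (cases "a \<in># N")
        case True
        show ?thesis by (rule const[OF N(1-3) True bN])
      next
        case False
        \<comment> \<open>The second element \<open>x\<close> of \<open>M\<close> survives the
          exchange of \<open>a\<close> for \<open>t\<close>. The chain runs from \<open>a\<close> to
          \<open>x\<close> in \<open>M\<close>, to \<open>t\<close> in the exchanged monomial, and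
          to \<open>b\<close> in \<open>N\<close>.\<close>
        then obtain t where t: "t \<in># N" "q (add_mset t (M - {#a#})) > 0"
          using exch[OF M(1) N(1) M(2) N(2) M(3) N(3) aM] by auto
        have "f x = f t"
          by (rule const[OF _ _ t(2)]) (use M N t xM' aM in \<open>auto dest: in_diffD simp: size_Diff_singleton\<close>)
        moreover have "f a = f x" by (rule const[OF M(1-3) aM xM])
        moreover have "f t = f b" by (rule const[OF N(1-3) t(1) bN])
        ultimately show ?thesis by simp
      qed
    next
      show "0 \<le> bform A B v v"
        unfolding bform_def
        using v w r0 by (auto intro!: sum_nonneg mult_nonneg_nonneg dderiv_nonneg less_imp_le[of 0 "w _"] simp: B_def)
    qed (use r0 w in \<open>auto simp: add_mset_commute\<close>)
    then show ?thesis by (simp add: dderiv_dderiv_empty B_def[abs_def] wws r_def)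
  qed
  show ?thesis
    unfolding alexandrov_fenchel_def
  proof (intro allI impI)
    fix ws :: "('a \<Rightarrow> real) list" and u v :: "'a \<Rightarrow> real"
    assume len: "length ws + 2 = Suc m" and ws: "\<forall>w\<in>set ws. \<forall>a\<in>A. 0 \<le> w a" and v: "\<forall>a\<in>A. 0 \<le> v a"
    \<comment> \<open>Both sides are continuous in the directions, so raising all of
      \<open>ws\<close> by a positive amount and letting it tend to 0 transfers the
      inequality.\<close>
    let ?ws = "\<lambda>\<epsilon>. map (\<lambda>w a. w a + \<epsilon>) ws"
    let ?D = "\<lambda>u v ws. dderiv A u (dderiv A v (dderivs A ws q)) {#}"
    have lim: "((\<lambda>\<epsilon>. ?D u v (?ws \<epsilon>)) \<longlongrightarrow> ?D u v ws) (at_right 0)" for u v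
      unfolding dderiv_def by (intro tendsto_intros tendsto_dderivs_perturb)
    show "?D u u ws * ?D v v ws \<le> (?D u v ws)\<^sup>2"
    proof (rule tendsto_le[OF _ tendsto_power[OF lim] tendsto_mult[OF lim lim]])
      show "\<forall>\<^sub>F \<epsilon> in at_right 0. ?D u u (?ws \<epsilon>) * ?D v v (?ws \<epsilon>) \<le> (?D u v (?ws \<epsilon>))\<^sup>2"
        using eventually_at_right_less
      proof eventually_elim
        case (elim \<epsilon>)
        show ?case by (rule pos) (use len ws v elim in \<open>auto intro: add_nonneg_pos\<close>)
      qed
    qed simp
  qed
qed

section \<open>Lorentzian polynomials\<close>

definition mset_expvec :: "'a multiset \<Rightarrow> 'a expvec" where
  "mset_expvec M = (\<Sum>a\<in>set_mset M. Poly_Mapping.single a (count M a))"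

lemma lookup_mset_expvec [simp]: "Poly_Mapping.lookup (mset_expvec M) a = count M a"
proof -
  have "Poly_Mapping.lookup (mset_expvec M) a = (\<Sum>b\<in>set_mset M. if b = a then count M b else 0)"
    by (simp add: mset_expvec_def lookup_sum lookup_single when_def)
  also have "\<dots> = count M a"
    by (auto simp: not_in_iff)
  finally show ?thesis .
qed

lemma mset_expvec_empty: "mset_expvec {#} = 0"
  by (simp add: mset_expvec_def)

lemma mset_expvec_add_mset: "mset_expvec (add_mset a M) = mset_expvec M + unit_vec a"
  by (rule poly_mapping_eqI) (simp add: lookup_add lookup_single when_def)

lemma keys_mset_expvec: "Poly_Mapping.keys (mset_expvec M) = set_mset M"
  by (auto simp: in_keys_iff)

lemma expvec_degree_mset_expvec: "expvec_degree (mset_expvec M) = size M"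
  by (simp add: expvec_degree_def keys_mset_expvec size_multiset_overloaded_eq)

lemma mset_expvec_surj:
  obtains M where "mset_expvec M = n"
proof
  show "mset_expvec (\<Sum>a\<in>Poly_Mapping.keys n. replicate_mset (Poly_Mapping.lookup n a) a) = n"
    by (rule poly_mapping_eqI) (simp add: count_sum in_keys_iff)
qed

lemma homogeneous_degree:
  assumes "homogeneous f" "n \<in> Poly_Mapping.keys f"
  shows "expvec_degree n = total_degree f"
proof -
  obtain d where d: "\<forall>n\<in>Poly_Mapping.keys f. expvec_degree n = d"
    using assms(1) by (auto simp: homogeneous_def)
  then have "expvec_degree ` Poly_Mapping.keys f = {d}" using assms(2) by auto
  then show ?thesis using d assms(2) by (simp add: total_degree_def)
qed

lemma total_degree_partial_deriv:
  assumes "homogeneous f" "partial_deriv a f \<noteq> 0"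
  shows "total_degree f = Suc (total_degree (partial_deriv a f))"
proof -
  have deg: "Suc (expvec_degree n) = total_degree f" if "n \<in> Poly_Mapping.keys (partial_deriv a f)" for n
  proof -
    obtain M where M: "mset_expvec M = n" by (rule mset_expvec_surj)
    have "n + unit_vec a \<in> Poly_Mapping.keys f"
      using that by (simp add: in_keys_iff lookup_partial_deriv)
    then have "mset_expvec (add_mset a M) \<in> Poly_Mapping.keys f" by (simp add: mset_expvec_add_mset M)
    then have "size (add_mset a M) = total_degree f"
      using homogeneous_degree[OF assms(1)] by (metis expvec_degree_mset_expvec)
    then show ?thesis by (simp add: M[symmetric] expvec_degree_mset_expvec)
  qed
  then have "homogeneous (partial_deriv a f)"
    unfolding homogeneous_def by (metis Suc_inject)
  moreover obtain n where "n \<in> Poly_Mapping.keys (partial_deriv a f)"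
    using assms(2) by (metis keys_eq_empty all_not_in_conv)
  ultimately show ?thesis using homogeneous_degree deg by metis
qed

text \<open>The factorials are what iterated differentiation leaves of the exponents: for
  \<open>M\<close> inside \<open>A\<close> this is the constant term of the derivative of
  \<open>f\<close> along \<open>M\<close>. It makes \<open>shift\<close> correspond exactly to
  \<open>partial_deriv\<close>.\<close>

definition mset_coeff :: "'a set \<Rightarrow> 'a rpoly \<Rightarrow> 'a multiset \<Rightarrow> real" where
  "mset_coeff A f M = Poly_Mapping.lookup f (mset_expvec M) * (\<Prod>a\<in>A. fact (count M a))"

lemma shift_mset_coeff:
  assumes "finite A" "a \<in> A"
  shows "shift a (mset_coeff A f) = mset_coeff A (partial_deriv a f)"
proof
  fix M
  have "(\<Prod>x\<in>A - {a}. fact (count (add_mset a M) x)) = (\<Prod>x\<in>A - {a}. fact (count M x) :: real)"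
    by (intro prod.cong) auto
  then have "(\<Prod>x\<in>A. fact (count (add_mset a M) x)) = real (Suc (count M a)) * (\<Prod>x\<in>A. fact (count M x))"
    using prod.remove[OF assms, of "\<lambda>x. fact (count (add_mset a M) x) :: real"]
      prod.remove[OF assms, of "\<lambda>x. fact (count M x) :: real"] by simp
  then show "shift a (mset_coeff A f) M = mset_coeff A (partial_deriv a f) M"
    by (simp add: shift_def mset_coeff_def lookup_partial_deriv mset_expvec_add_mset)
qed

lemma mset_coeff_nonneg:
  assumes "f \<in> nonneg_polys I"
  shows "0 \<le> mset_coeff A f M"
  using assms by (auto simp: mset_coeff_def nonneg_polys_def intro!: mult_nonneg_nonneg prod_nonneg)

lemma mset_coeff_pos_iff:
  assumes "f \<in> nonneg_polys I"
  shows "0 < mset_coeff A f M \<longleftrightarrow> mset_expvec M \<in> Poly_Mapping.keys f"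
proof -
  have "0 < (\<Prod>a\<in>A. fact (count M a) :: real)" by (intro prod_pos) auto
  then show ?thesis
    using assms by (auto simp: mset_coeff_def nonneg_polys_def in_keys_iff zero_less_mult_iff order_less_le)
qed

lemma dderivs_zero: "dderivs A ws (\<lambda>_. 0) = (\<lambda>_. 0)"
  by (induction ws) (simp_all add: fun_eq_iff dderiv_def)

lemma hessian_mset_coeff:
  assumes "finite A" "i \<in> A" "j \<in> A"
  shows "hessian f i j = mset_coeff A f {#i, j#}"
proof -
  have "mset_coeff A f {#i, j#} = shift i (shift j (mset_coeff A f)) {#}"
    by (simp add: shift_def add_mset_commute)
  also have "\<dots> = hessian f i j"
    using assms by (simp add: shift_mset_coeff hessian_def mset_coeff_def mset_expvec_empty)
  finally show ?thesis ..
qed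

lemma m_convex_exchange:
  assumes "m_convex A (Poly_Mapping.keys f)" "mset_expvec M \<in> Poly_Mapping.keys f"
    "mset_expvec N \<in> Poly_Mapping.keys f" "\<sigma> \<in> A" "\<sigma> \<in># M" "\<sigma> \<notin># N"
  obtains \<tau> where "\<tau> \<in># N" "mset_expvec (add_mset \<tau> (M - {#\<sigma>#})) \<in> Poly_Mapping.keys f"
proof -
  have "count N \<sigma> < count M \<sigma>"
    using assms(5,6) by (simp add: not_in_iff)
  then obtain \<tau> where "count M \<tau> < count N \<tau>"
    "mset_expvec M - unit_vec \<sigma> + unit_vec \<tau> \<in> Poly_Mapping.keys f"
    using assms(1-4) unfolding m_convex_def by fastforce
  moreover have "mset_expvec M - unit_vec \<sigma> = mset_expvec (M - {#\<sigma>#})"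
    by (rule poly_mapping_eqI) (simp add: lookup_minus lookup_single when_def)
  ultimately show ?thesis
    by (intro that[of \<tau>]) (auto simp: mset_expvec_add_mset intro: count_inI)
qed

text \<open>The Hessian condition gives degree 2; above it the partial derivatives supply the local
  hypothesis of \<open>alexandrov_fenchel_step\<close>, a vanishing one satisfying it
  trivially.\<close>

theorem lorentzian_alexandrov_fenchel:
  assumes A: "finite A" and "lorentzian A f" "total_degree f \<ge> 2"
  shows "alexandrov_fenchel A (total_degree f) (mset_coeff A f)"
  using assms(2,3)
proof (induction rule: lorentzian.induct)
  case (const f)
  then show ?case by simp
next
  case (step f)
  note nonneg = mset_coeff_nonneg[OF step.hyps(1)]
  show ?case
  proof (cases "total_degree f = 2")
    case True
    have H: "bform A (\<lambda>a b. mset_coeff A f {#a, b#}) u v = bform A (hessian f) u v" for u v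
      unfolding bform_def by (intro sum.cong refl) (simp add: hessian_mset_coeff[OF A])
    show ?thesis
      unfolding alexandrov_fenchel_def
    proof (intro allI impI)
      fix ws :: "('a \<Rightarrow> real) list" and u v :: "'a \<Rightarrow> real"
      assume "length ws + 2 = total_degree f" and v: "\<forall>a\<in>A. 0 \<le> v a"
      then have "ws = []" using True by simp
      moreover have "0 \<le> bform A (hessian f) v v"
        unfolding H[symmetric] unfolding bform_def using v by (auto intro!: sum_nonneg mult_nonneg_nonneg nonneg)
      ultimately show "dderiv A u (dderiv A u (dderivs A ws (mset_coeff A f))) {#} *
          dderiv A v (dderiv A v (dderivs A ws (mset_coeff A f))) {#}
          \<le> (dderiv A u (dderiv A v (dderivs A ws (mset_coeff A f))) {#})\<^sup>2"
        using antiferromagnetic_reverse_cauchy_schwarz[OF step.hyps(5)[OF True], of v u]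
        by (simp add: dderiv_dderiv_empty H)
    qed
  next
    case False
    then obtain m where m: "total_degree f = Suc m" "m \<ge> 2"
      using step.prems by (cases "total_degree f") auto
    have "alexandrov_fenchel A (Suc m) (mset_coeff A f)"
    proof (rule alexandrov_fenchel_step[OF A nonneg m(2)])
      fix a assume a: "a \<in> A"
      show "alexandrov_fenchel A m (shift a (mset_coeff A f))"
      proof (cases "partial_deriv a f = 0")
        case True
        then have "shift a (mset_coeff A f) = (\<lambda>_. 0)"
          by (simp add: shift_mset_coeff[OF A a] mset_coeff_def fun_eq_iff)
        then show ?thesis
          by (simp add: alexandrov_fenchel_def dderivs_zero dderiv_def)
      next
        case False
        then have "total_degree (partial_deriv a f) = m"
          using total_degree_partial_deriv[OF step.hyps(3)] m(1) by simp
        then show ?thesis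
          using step.IH[OF _ a] False m unfolding shift_mset_coeff[OF A a] by auto
      qed
    next
      fix M N \<sigma>
      assume *: "set_mset M \<subseteq> A" "0 < mset_coeff A f M" "0 < mset_coeff A f N" "\<sigma> \<in># M" "\<sigma> \<notin># N"
      show "\<exists>\<tau>\<in>#N. 0 < mset_coeff A f (add_mset \<tau> (M - {#\<sigma>#}))"
        by (rule m_convex_exchange[OF step.hyps(4), of M N \<sigma>])
          (use * in \<open>auto simp: mset_coeff_pos_iff[OF step.hyps(1)]\<close>)
    qed
    then show ?thesis by (simp add: m)
  qed
qed

section \<open>Entropy inequalities for symmetric weights\<close>

lemma tuples_0: "tuples A 0 = {[]}"
  by (auto simp: tuples_def)

lemma tuples_Suc: "tuples A (Suc n) = (\<lambda>(a, \<omega>). a # \<omega>) ` (A \<times> tuples A n)"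
  by (auto simp: tuples_def length_Suc_conv image_iff)

lemma finite_tuples: "finite A \<Longrightarrow> finite (tuples A n)"
  by (induction n) (auto simp: tuples_0 tuples_Suc)

lemma sum_tuples_Suc: "(\<Sum>\<omega>\<in>tuples A (Suc n). F \<omega>) = (\<Sum>a\<in>A. \<Sum>\<omega>\<in>tuples A n. F (a # \<omega>))"
proof -
  have "inj_on (\<lambda>(a, \<omega>). a # \<omega>) (A \<times> tuples A n)" by (auto simp: inj_on_def)
  then show ?thesis by (simp add: tuples_Suc sum.reindex sum.cartesian_product comp_def split_def)
qed

text \<open>As the weights are symmetric, it makes no difference which coordinates are summed
  out.\<close>

definition marginal :: "'a set \<Rightarrow> nat \<Rightarrow> ('a multiset \<Rightarrow> real) \<Rightarrow> 'a multiset \<Rightarrow> real" where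
  "marginal A k = dderiv A (\<lambda>_. 1) ^^ k"

lemma marginal_0 [simp]: "marginal A 0 g = g"
  by (simp add: marginal_def)

lemma marginal_Suc: "marginal A (Suc k) g M = (\<Sum>a\<in>A. marginal A k g (add_mset a M))"
  by (simp add: marginal_def dderiv_def)

lemma marginal_marginal: "marginal A k (marginal A l g) = marginal A (k + l) g"
  by (simp add: marginal_def funpow_add)

lemma funpow_dderiv_shift: "(dderiv A w ^^ k) (shift a g) = shift a ((dderiv A w ^^ k) g)"
  by (induction k) (simp_all add: dderiv_shift)

lemma marginal_shift: "marginal A k (shift a g) = shift a (marginal A k g)"
  by (simp add: marginal_def funpow_dderiv_shift)

lemma marginal_nonneg: "(\<And>M. 0 \<le> g M) \<Longrightarrow> 0 \<le> marginal A k g M"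
  by (induction k arbitrary: M) (simp_all add: marginal_Suc sum_nonneg)

text \<open>Each coordinate contributes one derivative in direction \<open>x\<close>. Through this
  identity the Alexandrov-Fenchel inequality acts on product moments of a law.\<close>

lemma sum_tuples_prod:
  "(\<Sum>\<omega>\<in>tuples A n. g (mset \<omega> + M) * prod_list (map x \<omega>)) = (dderiv A x ^^ n) g M"
proof (induction n arbitrary: M)
  case (Suc n)
  have "(\<Sum>\<omega>\<in>tuples A n. g (add_mset a (mset \<omega> + M)) * (x a * prod_list (map x \<omega>))) =
      x a * (dderiv A x ^^ n) g (add_mset a M)" for a
    by (simp add: Suc[symmetric] sum_distrib_left mult_ac)
  then show ?case by (simp add: sum_tuples_Suc dderiv_def[of A x "(dderiv A x ^^ n) g"])
qed (simp add: tuples_0)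

lemma sum_tuples_marginal: "(\<Sum>\<omega>\<in>tuples A n. g (mset \<omega> + M)) = marginal A n g M"
  using sum_tuples_prod[of g M "\<lambda>_. 1" A n]
  by (simp add: marginal_def map_replicate_const)

text \<open>By symmetry each of the \<open>n\<close> coordinates contributes the same single-letter
  sum. At \<open>n = 0\<close> the truncated \<open>n - 1\<close> is harmless, as the factor
  \<open>real n\<close> vanishes.\<close>

lemma sum_tuples_sum:
  "(\<Sum>\<omega>\<in>tuples A n. g (mset \<omega> + M) * sum_list (map y \<omega>)) =
     real n * (\<Sum>a\<in>A. y a * marginal A (n - 1) g (add_mset a M))"
proof (induction n arbitrary: M)
  case (Suc n)
  have "(\<Sum>\<omega>\<in>tuples A (Suc n). g (mset \<omega> + M) * sum_list (map y \<omega>)) =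
      (\<Sum>a\<in>A. \<Sum>\<omega>\<in>tuples A n. y a * g (mset \<omega> + add_mset a M)) +
      (\<Sum>a\<in>A. \<Sum>\<omega>\<in>tuples A n. g (mset \<omega> + add_mset a M) * sum_list (map y \<omega>))"
    by (simp add: sum_tuples_Suc sum.distrib ring_distribs mult.commute)
  also have "(\<Sum>a\<in>A. \<Sum>\<omega>\<in>tuples A n. y a * g (mset \<omega> + add_mset a M)) =
      (\<Sum>a\<in>A. y a * marginal A n g (add_mset a M))"
    unfolding sum_distrib_left[symmetric] sum_tuples_marginal ..
  also have "(\<Sum>a\<in>A. \<Sum>\<omega>\<in>tuples A n. g (mset \<omega> + add_mset a M) * sum_list (map y \<omega>)) =
      real n * (\<Sum>a\<in>A. \<Sum>b\<in>A. y b * marginal A (n - 1) g (add_mset a (add_mset b M)))"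
    unfolding Suc.IH sum_distrib_left by (simp add: add_mset_commute)
  also have "\<dots> = real n * (\<Sum>b\<in>A. y b * marginal A n g (add_mset b M))"
  proof (cases n)
    case (Suc l)
    have "(\<Sum>a\<in>A. \<Sum>b\<in>A. y b * marginal A l g (add_mset a (add_mset b M))) =
        (\<Sum>b\<in>A. y b * marginal A n g (add_mset b M))"
      unfolding Suc marginal_Suc sum_distrib_left by (rule sum.swap)
    then show ?thesis by (simp add: Suc)
  qed simp
  finally show ?case by (simp add: algebra_simps)
qed (simp add: tuples_0)

text \<open>
  The weights \<open>g\<close> need not sum to one, because the entropy inequality is proved by conditioning on a
  coordinate without renormalising.
\<close>

definition tuple_entropy :: "'a set \<Rightarrow> nat \<Rightarrow> ('a multiset \<Rightarrow> real) \<Rightarrow> real" where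
  "tuple_entropy A n g = - (\<Sum>\<omega>\<in>tuples A n. g (mset \<omega>) * ln (g (mset \<omega>)))"

text \<open>Splitting off a coordinate costs no correction term because the conditioned weights are
  not renormalised.\<close>

lemma tuple_entropy_Suc: "tuple_entropy A (Suc n) g = (\<Sum>a\<in>A. tuple_entropy A n (shift a g))"
  by (simp add: tuple_entropy_def sum_tuples_Suc shift_def sum_negf)

lemma tuple_entropy_0: "tuple_entropy A 0 g = - (g {#} * ln (g {#}))"
  by (simp add: tuple_entropy_def tuples_0)

lemma tuple_entropy_1: "tuple_entropy A 1 g = - (\<Sum>a\<in>A. g {#a#} * ln (g {#a#}))"
  by (simp add: tuple_entropy_Suc tuple_entropy_0 shift_def sum_negf)

lemma tuple_entropy_2: "tuple_entropy A 2 g = - (\<Sum>c\<in>A. \<Sum>a\<in>A. g {#a, c#} * ln (g {#a, c#}))"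
  by (simp add: numeral_2_eq_2 tuple_entropy_Suc tuple_entropy_0 shift_def sum_negf add_mset_commute)

lemma dderivs_append: "dderivs A (us @ ws) q = dderivs A us (dderivs A ws q)"
  by (simp add: dderivs_def)

lemma dderivs_replicate: "dderivs A (replicate n w) q = (dderiv A w ^^ n) q"
  by (induction n) simp_all

lemma funpow_dderiv_commute:
  "(dderiv A x ^^ j) (dderiv A y q) = dderiv A y ((dderiv A x ^^ j) q)"
  by (simp add: dderivs_replicate[symmetric] dderivs_dderiv)

text \<open>Log-concavity makes the successive ratios of the product moments nonincreasing. The
  first ratio is at most 1 by \<open>first\<close>, so the moments never exceed the initial
  one.\<close>

lemma alexandrov_fenchel_power_le:
  assumes A: "finite A" and k: "\<And>M. 0 \<le> k M" and AF: "alexandrov_fenchel A d k"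
    and x: "\<And>a. a \<in> A \<Longrightarrow> 0 \<le> x a"
    and first: "(\<Sum>a\<in>A. x a * marginal A (d - 1) k {#a#}) \<le> marginal A d k {#}"
  shows "(dderiv A x ^^ d) k {#} \<le> marginal A d k {#}"
proof -
  define t where "t j = (dderiv A x ^^ j) (marginal A (d - j) k) {#}" for j
  have "t (Suc j) \<le> t j" if "j < d" for j
    using that
  proof (induction j)
    case 0
    then show ?case using first by (simp add: t_def dderiv_def)
  next
    case (Suc j)
    define r where "r = (dderiv A x ^^ j) (marginal A (d - Suc (Suc j)) k)"
    have d: "d - Suc j = Suc (d - Suc (Suc j))" "d - j = Suc (Suc (d - Suc (Suc j)))"
      using Suc.prems by auto
    have t: "t j = dderiv A (\<lambda>_. 1) (dderiv A (\<lambda>_. 1) r) {#}"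
        "t (Suc j) = dderiv A x (dderiv A (\<lambda>_. 1) r) {#}"
        "t (Suc (Suc j)) = dderiv A x (dderiv A x r) {#}"
      unfolding t_def r_def d marginal_def by (simp_all add: funpow_dderiv_commute)
    define ws where "ws = replicate j x @ replicate (d - Suc (Suc j)) (\<lambda>_::'a. 1 :: real)"
    have r: "r = dderivs A ws k"
      by (simp add: ws_def r_def dderivs_append dderivs_replicate marginal_def)
    have ws: "0 \<le> w a" if "w \<in> set ws" "a \<in> A" for w a
      using that x by (auto simp: ws_def split: if_splits)
    \<comment> \<open>Alexandrov-Fenchel with \<open>x\<close> and the all-ones vector as the two
      varying directions; \<open>ws\<close> holds the ones common to all three terms.\<close>
    have lc: "t (Suc (Suc j)) * t j \<le> (t (Suc j))\<^sup>2"
      unfolding t r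
      by (rule alexandrov_fenchelD[OF AF]) (use ws Suc.prems in \<open>auto simp: ws_def\<close>)
    have r0: "0 \<le> r M" for M
      unfolding r by (rule dderivs_nonneg[OF k]) (rule ws)
    have IH: "t (Suc j) \<le> t j" using Suc by simp
    have pos: "0 \<le> t (Suc j)"
      unfolding t by (intro dderiv_nonneg r0 x) auto
    show ?case
    proof (cases "t (Suc j) = 0")
      case True
      \<comment> \<open>There is no ratio to compare when \<open>t (Suc j)\<close> is zero; instead
        the nonnegative weights \<open>?q\<close> vanish at every single letter, which forces the
        next moment to zero.\<close>
      let ?q = "dderiv A x r"
      have q0: "0 \<le> ?q M" for M by (intro dderiv_nonneg r0 x)
      have "(\<Sum>a\<in>A. ?q {#a#}) = 0"
        using True unfolding t by (subst (asm) dderiv_commute) (simp add: dderiv_def)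
      then have "?q {#a#} = 0" if "a \<in> A" for a
        using that q0 A by (simp add: sum_nonneg_eq_0_iff)
      then have "t (Suc (Suc j)) = 0"
        unfolding t by (subst dderiv_def) simp
      then show ?thesis using pos by simp
    next
      case False
      then have "0 < t (Suc j)" using pos by simp
      moreover have "t (Suc (Suc j)) * t j \<le> t (Suc j) * t j"
        using lc mult_left_mono[OF IH pos] by (simp add: power2_eq_square)
      ultimately show ?thesis using IH by simp
    qed
  qed
  note step = this
  have "t i \<le> t 0" if "i \<le> d" for i
    using that
  proof (induction i)
    case (Suc i)
    then show ?case using step[of i] by simp
  qed simp
  then have "t d \<le> t 0" by simp
  then show ?thesis by (simp add: t_def)
qed

section \<open>Gibbs' inequality and the mutual information bound\<close>

lemma ln_prod_list:
  assumes "\<And>a. a \<in> set \<omega> \<Longrightarrow> 0 < (x a :: real)"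
  shows "0 < prod_list (map x \<omega>) \<and> ln (prod_list (map x \<omega>)) = sum_list (map (\<lambda>a. ln (x a)) \<omega>)"
  using assms by (induction \<omega>) (auto simp: ln_mult_pos)

text \<open>From ln t <= t - 1 at t = r / p. Summed up, it gives Gibbs' inequality for unnormalised
  weights as long as \<open>r\<close> has no more total mass than \<open>p\<close>.\<close>

lemma gibbs_pointwise:
  fixes p r :: real
  assumes "0 \<le> p" "0 \<le> r" "0 < p \<Longrightarrow> 0 < r"
  shows "p - r \<le> p * (ln p - ln r)"
proof (cases "p = 0")
  case False
  then have p: "0 < p" "0 < r" using assms by auto
  have "ln (r / p) \<le> r / p - 1" using p by (intro ln_le_minus_one) simp
  then have "p * ln (r / p) \<le> p * (r / p - 1)" using p by (intro mult_left_mono) auto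
  also have "\<dots> = r - p" using p by (simp add: field_simps)
  finally show ?thesis using p by (simp add: ln_divide_pos algebra_simps)
qed (use assms in simp)

text \<open>Gibbs' inequality for the weights \<open>\<nu>\<close>, with one coordinate fixed to
  \<open>c\<close>, against the marginal \<open>k\<close> of the others, tilted in every coordinate
  by its likelihood ratio given \<open>c\<close>. Alexandrov-Fenchel for \<open>k\<close> shows that
  the tilted weights are no heavier than \<open>\<nu>\<close>.\<close>

lemma entropic_independence_conditional:
  fixes g :: "'a multiset \<Rightarrow> real"
  assumes A: "finite A" and g: "\<And>M. 0 \<le> g M" and d: "d \<ge> 1"
    and AF: "alexandrov_fenchel A d (marginal A 1 g)" and c: "c \<in> A"
  defines "Z \<equiv> marginal A (Suc d) g {#}" and "p \<equiv> \<lambda>a. marginal A d g {#a#}"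
    and "P \<equiv> \<lambda>a c. marginal A (d - 1) g {#a, c#}"
  shows "real d * (\<Sum>a\<in>A. P a c * (ln (P a c) + ln Z - ln (p a) - ln (p c))) + p c * (ln (p c) - ln Z)
    \<le> (\<Sum>\<omega>\<in>tuples A d. g (add_mset c (mset \<omega>)) *
          (ln (g (add_mset c (mset \<omega>))) - ln (marginal A 1 g (mset \<omega>))))"
proof -
  define k where "k = marginal A 1 g"
  define \<nu> where "\<nu> \<omega> = g (add_mset c (mset \<omega>))" for \<omega>
  define y where "y a = ln (P a c) + ln Z - ln (p a) - ln (p c)" for a
  have k0: "0 \<le> k M" for M unfolding k_def by (rule marginal_nonneg[OF g])
  have p0: "0 \<le> p a" for a unfolding p_def by (rule marginal_nonneg[OF g])
  have P0: "0 \<le> P a b" for a b unfolding P_def by (rule marginal_nonneg[OF g])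
  have Zp: "Z = (\<Sum>a\<in>A. p a)" by (simp add: Z_def p_def marginal_Suc)
  have pP: "p a = (\<Sum>c\<in>A. P a c)" for a
    using d by (cases d) (simp_all add: p_def P_def marginal_Suc add_mset_commute)
  have symP: "P a b = P b a" for a b by (simp add: P_def add_mset_commute)
  have Pp: "P a b \<le> p a" if "b \<in> A" for a b
    unfolding pP using that A P0 by (intro member_le_sum) auto
  have pZ: "p a \<le> Z" if "a \<in> A" for a
    unfolding Zp using that A p0 by (intro member_le_sum) auto
  have \<nu>p: "(\<Sum>\<omega>\<in>tuples A d. \<nu> \<omega>) = p c"
    using sum_tuples_marginal[of g "{#c#}" A d] by (simp add: \<nu>_def p_def)
  have \<nu>y: "(\<Sum>\<omega>\<in>tuples A d. \<nu> \<omega> * sum_list (map y \<omega>)) = real d * (\<Sum>a\<in>A. P a c * y a)"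
    using sum_tuples_sum[of g "{#c#}" y A d] by (simp add: \<nu>_def P_def mult.commute)
  \<comment> \<open>With \<open>Pp\<close> and \<open>\<nu>k\<close>, this domination makes the
    arguments of the logarithms positive wherever \<open>\<nu> \<omega>\<close> is; elsewhere the
    term is multiplied by zero.\<close>
  have \<nu>P: "\<nu> \<omega> \<le> P a c" if \<omega>: "\<omega> \<in> tuples A d" and a: "a \<in> set \<omega>" for \<omega> a
  proof -
    have \<omega>': "remove1 a \<omega> \<in> tuples A (d - 1)"
      using \<omega> a set_remove1_subset[of a \<omega>] by (auto simp: tuples_def length_remove1)
    have "add_mset c (mset \<omega>) = mset (remove1 a \<omega>) + {#a, c#}"
      using a by simp
    then have "\<nu> \<omega> = g (mset (remove1 a \<omega>) + {#a, c#})"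
      unfolding \<nu>_def by (rule arg_cong)
    also have "\<dots> \<le> (\<Sum>\<omega>\<in>tuples A (d - 1). g (mset \<omega> + {#a, c#}))"
      using \<omega>' g by (intro member_le_sum finite_tuples[OF A]) auto
    finally show ?thesis unfolding sum_tuples_marginal P_def .
  qed
  have \<nu>k: "\<nu> \<omega> \<le> k (mset \<omega>)" for \<omega>
  proof -
    have "k (mset \<omega>) = (\<Sum>a\<in>A. g (add_mset a (mset \<omega>)))"
      by (simp add: k_def marginal_Suc)
    then show ?thesis
      using member_le_sum[of c A "\<lambda>a. g (add_mset a (mset \<omega>))"] c g A by (simp add: \<nu>_def)
  qed
  have "0 \<le> (\<Sum>\<omega>\<in>tuples A d. \<nu> \<omega> * (ln (\<nu> \<omega>) - (ln (k (mset \<omega>)) + sum_list (map y \<omega>) + (ln (p c) - ln Z))))"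
  proof (cases "p c = 0")
    case True
    have "\<nu> \<omega> = 0" if "\<omega> \<in> tuples A d" for \<omega>
      using True that g finite_tuples[OF A] unfolding \<nu>p[symmetric] by (simp add: sum_nonneg_eq_0_iff \<nu>_def)
    then show ?thesis by simp
  next
    case False
    then have pc: "0 < p c" using p0[of c] by simp
    then have Z: "0 < Z" using pZ[OF c] by simp
    define x where "x a = P a c * Z / (p a * p c)" for a
      \<comment> \<open>the likelihood ratio of one coordinate given \<open>c\<close>; the product of these weights is the test function in Gibbs' inequality\<close>
    define r where "r \<omega> = k (mset \<omega>) * prod_list (map x \<omega>) * (p c / Z)" for \<omega>
    have x0: "0 \<le> x a" for a using P0 p0 pc Z by (simp add: x_def)
    have "(dderiv A x ^^ d) k {#} \<le> marginal A d k {#}"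
    proof (rule alexandrov_fenchel_power_le[OF A k0 AF[folded k_def] x0])
      have "marginal A (d - 1) k = marginal A d g" "marginal A d k = marginal A (Suc d) g"
        using d by (simp_all add: k_def marginal_marginal)
      then have "(\<Sum>a\<in>A. x a * marginal A (d - 1) k {#a#}) = (\<Sum>a\<in>A. x a * p a)" "marginal A d k {#} = Z"
        by (simp_all add: p_def Z_def)
      \<comment> \<open>At \<open>p a = 0\<close> both sides vanish because
        \<open>P a c \<le> p a\<close>. Summation then gives \<open>x\<close> mean 1 under the
        normalised \<open>k\<close>, so the hypothesis on the first moment holds with
        equality.\<close>
      moreover have "x a * p a = P a c * (Z / p c)" if "a \<in> A" for a
        using Pp[OF c, of a] P0[of a c] by (cases "p a = 0") (simp_all add: x_def)
      then have "(\<Sum>a\<in>A. x a * p a) = (\<Sum>a\<in>A. P a c) * (Z / p c)"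
        unfolding sum_distrib_right by (rule sum.cong[OF refl])
      moreover have "(\<Sum>a\<in>A. P a c) = p c"
        unfolding pP by (rule sum.cong[OF refl symP])
      ultimately show "(\<Sum>a\<in>A. x a * marginal A (d - 1) k {#a#}) \<le> marginal A d k {#}"
        using pc by simp
    qed
    moreover have "marginal A d k {#} = Z"
      by (simp add: k_def Z_def marginal_marginal)
    moreover have "(\<Sum>\<omega>\<in>tuples A d. r \<omega>) = (dderiv A x ^^ d) k {#} * (p c / Z)"
      using sum_tuples_prod[of k "{#}" x A d] by (simp add: r_def sum_distrib_right[symmetric] sum_divide_distrib[symmetric])
    ultimately have "(\<Sum>\<omega>\<in>tuples A d. r \<omega>) \<le> Z * (p c / Z)"
      using pc Z by (simp only:) (rule mult_right_mono, simp_all)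
    then have sum_r: "(\<Sum>\<omega>\<in>tuples A d. r \<omega>) \<le> p c"
      using Z by simp
    have "\<nu> \<omega> - r \<omega> \<le> \<nu> \<omega> * (ln (\<nu> \<omega>) - (ln (k (mset \<omega>)) + sum_list (map y \<omega>) + (ln (p c) - ln Z)))"
      if \<omega>: "\<omega> \<in> tuples A d" for \<omega>
    proof (cases "\<nu> \<omega> = 0")
      case True
      have "0 \<le> prod_list (map x \<omega>)"
        by (rule prod_list_nonneg) (auto simp: x0)
      then have "0 \<le> r \<omega>"
        unfolding r_def by (intro mult_nonneg_nonneg k0 divide_nonneg_nonneg) (use pc Z in simp_all)
      then show ?thesis using True by simp
    next
      case False
      then have \<nu>0: "0 < \<nu> \<omega>" using g[of "add_mset c (mset \<omega>)"] by (simp add: \<nu>_def)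
      have xy: "0 < x a \<and> ln (x a) = y a" if "a \<in> set \<omega>" for a
      proof -
        have "0 < P a c" using \<nu>P[OF \<omega> that] \<nu>0 by simp
        moreover from this have "0 < p a" using Pp[OF c, of a] by simp
        ultimately show ?thesis using pc Z by (simp add: x_def y_def ln_div ln_mult)
      qed
      then have map_y: "map (\<lambda>a. ln (x a)) \<omega> = map y \<omega>" by simp
      have "0 < prod_list (map x \<omega>) \<and> ln (prod_list (map x \<omega>)) = sum_list (map (\<lambda>a. ln (x a)) \<omega>)"
        by (rule ln_prod_list) (simp add: xy)
      then have prod: "0 < prod_list (map x \<omega>)" "ln (prod_list (map x \<omega>)) = sum_list (map y \<omega>)"
        unfolding map_y by blast+
      have kk: "0 < k (mset \<omega>)" using \<nu>k[of \<omega>] \<nu>0 by simp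
      have "0 < r \<omega>" using prod kk pc Z by (simp add: r_def)
      moreover have "ln (r \<omega>) = ln (k (mset \<omega>)) + sum_list (map y \<omega>) + (ln (p c) - ln Z)"
      proof -
        have "ln (r \<omega>) = ln (k (mset \<omega>)) + ln (prod_list (map x \<omega>)) + ln (p c / Z)"
          unfolding r_def by (subst ln_mult_pos | use prod(1) kk pc Z in simp)+
        then show ?thesis using pc Z by (simp only: prod(2) ln_divide_pos)
      qed
      ultimately show ?thesis using gibbs_pointwise[of "\<nu> \<omega>" "r \<omega>"] \<nu>0 by simp
    qed
    then have "(\<Sum>\<omega>\<in>tuples A d. \<nu> \<omega> - r \<omega>) \<le>
      (\<Sum>\<omega>\<in>tuples A d. \<nu> \<omega> * (ln (\<nu> \<omega>) - (ln (k (mset \<omega>)) + sum_list (map y \<omega>) + (ln (p c) - ln Z))))"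
      by (rule sum_mono)
    then show ?thesis using sum_r \<nu>p by (simp add: sum_subtractf)
  qed
  also have "\<dots> = (\<Sum>\<omega>\<in>tuples A d. \<nu> \<omega> * (ln (\<nu> \<omega>) - ln (k (mset \<omega>))))
      - (\<Sum>\<omega>\<in>tuples A d. \<nu> \<omega> * sum_list (map y \<omega>)) - (\<Sum>\<omega>\<in>tuples A d. \<nu> \<omega>) * (ln (p c) - ln Z)"
    unfolding sum_distrib_right sum_subtractf[symmetric] by (intro sum.cong refl) (simp add: algebra_simps)
  finally show ?thesis unfolding \<nu>y \<nu>p by (simp add: \<nu>_def k_def y_def)
qed

text \<open>
  In terms of the tuple \<open>(X\<^sub>0, \<dots>, X\<^sub>d)\<close> of law \<open>g\<close>: the mutual information of \<open>X\<^sub>0\<close> and the other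
  \<open>d\<close> coordinates is at least \<open>d\<close> times that of \<open>X\<^sub>0\<close> and \<open>X\<^sub>1\<close>.
\<close>

lemma entropic_independence:
  fixes g :: "'a multiset \<Rightarrow> real"
  assumes A: "finite A" and g: "\<And>M. 0 \<le> g M" and d: "d \<ge> 1"
    and AF: "alexandrov_fenchel A d (marginal A 1 g)"
  shows "real d * (2 * tuple_entropy A 1 (marginal A d g) - tuple_entropy A 2 (marginal A (d - 1) g)
            - tuple_entropy A 0 (marginal A (Suc d) g))
    \<le> tuple_entropy A 1 (marginal A d g) + tuple_entropy A d (marginal A 1 g)
       - tuple_entropy A (Suc d) g - tuple_entropy A 0 (marginal A (Suc d) g)"
proof -
  have rearrange: "c * (2 * - y - - x - - z) \<le> - y + s - t - - z"
    if "c * (x + z - 2 * y) + (y - z) \<le> s - t" for c x y z s t :: real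
  proof -
    have "c * (2 * - y - - x - - z) = c * (x + z - 2 * y)"
      by (rule arg_cong[where f = "\<lambda>t. c * t"]) simp
    then show ?thesis using that by linarith
  qed
  define Z where "Z = marginal A (Suc d) g {#}"
  define p where "p a = marginal A d g {#a#}" for a
  define P where "P a c = marginal A (d - 1) g {#a, c#}" for a c
  define k where "k = marginal A 1 g"
  have Zp: "(\<Sum>a\<in>A. p a) = Z" by (simp add: Z_def p_def marginal_Suc)
  have pP: "(\<Sum>c\<in>A. P a c) = p a" for a
    using d by (cases d) (simp_all add: p_def P_def marginal_Suc add_mset_commute)
  have col: "(\<Sum>a\<in>A. P a c) = p c" for c
    unfolding pP[symmetric] by (intro sum.cong refl) (simp add: P_def add_mset_commute)
  have S0: "tuple_entropy A 0 (marginal A (Suc d) g) = - (Z * ln Z)"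
    by (simp add: tuple_entropy_0 Z_def)
  have S1: "tuple_entropy A 1 (marginal A d g) = - (\<Sum>a\<in>A. p a * ln (p a))"
    unfolding tuple_entropy_1 p_def ..
  have S2: "tuple_entropy A 2 (marginal A (d - 1) g) = - (\<Sum>c\<in>A. \<Sum>a\<in>A. P a c * ln (P a c))"
    unfolding tuple_entropy_2 P_def ..
  \<comment> \<open>Summing \<open>g\<close> over the letter \<open>c\<close> gives
    \<open>k\<close>, so the conditional terms add up to a difference of two entropies.\<close>
  have "(\<Sum>c\<in>A. \<Sum>\<omega>\<in>tuples A d. g (add_mset c (mset \<omega>)) * ln (k (mset \<omega>))) =
      (\<Sum>\<omega>\<in>tuples A d. k (mset \<omega>) * ln (k (mset \<omega>)))"
    by (subst sum.swap) (simp add: k_def marginal_Suc sum_distrib_right)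
  then have Sd: "(\<Sum>c\<in>A. \<Sum>\<omega>\<in>tuples A d. g (add_mset c (mset \<omega>)) *
          (ln (g (add_mset c (mset \<omega>))) - ln (k (mset \<omega>)))) =
      tuple_entropy A d k - tuple_entropy A (Suc d) g"
    by (simp add: right_diff_distrib sum_subtractf tuple_entropy_def sum_tuples_Suc)
  have "(\<Sum>c\<in>A. real d * (\<Sum>a\<in>A. P a c * (ln (P a c) + ln Z - ln (p a) - ln (p c))) + p c * (ln (p c) - ln Z))
      \<le> tuple_entropy A d k - tuple_entropy A (Suc d) g"
    unfolding Sd[symmetric]
  proof (rule sum_mono)
    fix c assume "c \<in> A"
    from entropic_independence_conditional[where g = g, OF A g d AF this]
    show "real d * (\<Sum>a\<in>A. P a c * (ln (P a c) + ln Z - ln (p a) - ln (p c))) + p c * (ln (p c) - ln Z)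
        \<le> (\<Sum>\<omega>\<in>tuples A d. g (add_mset c (mset \<omega>)) *
          (ln (g (add_mset c (mset \<omega>))) - ln (k (mset \<omega>))))"
      unfolding Z_def p_def P_def k_def .
  qed
  moreover have "(\<Sum>c\<in>A. \<Sum>a\<in>A. P a c * (ln (P a c) + ln Z - ln (p a) - ln (p c))) =
      (\<Sum>c\<in>A. \<Sum>a\<in>A. P a c * ln (P a c)) + Z * ln Z - 2 * (\<Sum>a\<in>A. p a * ln (p a))"
  proof -
    have "(\<Sum>c\<in>A. \<Sum>a\<in>A. P a c * ln Z) = Z * ln Z"
      by (simp add: sum_distrib_right[symmetric] col Zp)
    moreover have "(\<Sum>c\<in>A. \<Sum>a\<in>A. P a c * ln (p a)) = (\<Sum>a\<in>A. p a * ln (p a))"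
      by (subst sum.swap) (simp add: sum_distrib_right[symmetric] pP)
    moreover have "(\<Sum>c\<in>A. \<Sum>a\<in>A. P a c * ln (p c)) = (\<Sum>a\<in>A. p a * ln (p a))"
      by (simp add: sum_distrib_right[symmetric] col)
    ultimately show ?thesis
      by (simp add: algebra_simps sum.distrib sum_subtractf)
  qed
  moreover have "(\<Sum>c\<in>A. p c * (ln (p c) - ln Z)) = (\<Sum>a\<in>A. p a * ln (p a)) - Z * ln Z"
    by (simp add: right_diff_distrib sum_subtractf sum_distrib_right[symmetric] Zp)
  ultimately have "real d * ((\<Sum>c\<in>A. \<Sum>a\<in>A. P a c * ln (P a c)) + Z * ln Z - 2 * (\<Sum>a\<in>A. p a * ln (p a)))
      + ((\<Sum>a\<in>A. p a * ln (p a)) - Z * ln Z) \<le> tuple_entropy A d k - tuple_entropy A (Suc d) g"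
    by (simp only: sum.distrib sum_distrib_left[symmetric])
  then have le: "real d * (2 * - (\<Sum>a\<in>A. p a * ln (p a)) - - (\<Sum>c\<in>A. \<Sum>a\<in>A. P a c * ln (P a c)) - - (Z * ln Z))
      \<le> - (\<Sum>a\<in>A. p a * ln (p a)) + tuple_entropy A d k - tuple_entropy A (Suc d) g - - (Z * ln Z)"
    by (rule rearrange)
  show ?thesis
    unfolding S0 S1 S2 k_def[symmetric] by (rule le)
qed

text \<open>The last term on the left corrects for the total mass: with it the entropy coefficients
  sum to \<open>m\<close> on both sides, so the inequality is invariant under scaling and can be
  applied to the conditioned weights \<open>shift a g\<close>. At \<open>m = 2\<close> both sides
  coincide.\<close>

lemma tuple_entropy_inequality:
  fixes g :: "'a multiset \<Rightarrow> real"
  assumes A: "finite A" and "\<And>M. 0 \<le> g M" and "m \<ge> 2" and "alexandrov_fenchel A m g"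
  shows "(real m - 2) * tuple_entropy A m g + real m * tuple_entropy A 1 (marginal A (m - 1) g)
      - (real m - 2) * tuple_entropy A 0 (marginal A m g)
    \<le> real m * tuple_entropy A (m - 1) (marginal A 1 g)"
  using assms(3,2,4)
proof (induction m arbitrary: g rule: dec_induct)
  case base
  then show ?case by simp
next
  case (step m)
  have m: "1 \<le> m" "2 \<le> m" using step.hyps by auto
  obtain l where l: "m = Suc l" using m by (cases m) auto
  have AF: "alexandrov_fenchel A m (marginal A 1 g)"
    unfolding marginal_def using alexandrov_fenchel_dderiv[OF step.prems(2) m(2)] by simp
  have "(\<Sum>a\<in>A. (real m - 2) * tuple_entropy A m (shift a g)
        + real m * tuple_entropy A 1 (marginal A (m - 1) (shift a g))
        - (real m - 2) * tuple_entropy A 0 (marginal A m (shift a g)))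
      \<le> (\<Sum>a\<in>A. real m * tuple_entropy A (m - 1) (marginal A 1 (shift a g)))"
  proof (rule sum_mono, rule step.IH)
    fix a assume "a \<in> A"
    then show "alexandrov_fenchel A m (shift a g)"
      by (rule alexandrov_fenchel_shift[OF A step.prems(2) m(2)])
  qed (simp add: shift_def step.prems(1))
  \<comment> \<open>Conditioned entropies summed over \<open>a\<close> are entropies with one more
    coordinate; the mass corrections become a single-coordinate entropy.\<close>
  then have "(real m - 2) * tuple_entropy A (Suc m) g + real m * tuple_entropy A 2 (marginal A (m - 1) g)
      - (real m - 2) * tuple_entropy A 1 (marginal A m g) \<le> real m * tuple_entropy A m (marginal A 1 g)"
    unfolding marginal_shift sum.distrib sum_subtractf sum_distrib_left[symmetric]
      tuple_entropy_Suc[symmetric] by (simp add: l numeral_2_eq_2)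
  moreover have "real m * (2 * tuple_entropy A 1 (marginal A m g) - tuple_entropy A 2 (marginal A (m - 1) g)
            - tuple_entropy A 0 (marginal A (Suc m) g))
    \<le> tuple_entropy A 1 (marginal A m g) + tuple_entropy A m (marginal A 1 g)
       - tuple_entropy A (Suc m) g - tuple_entropy A 0 (marginal A (Suc m) g)"
    by (rule entropic_independence[OF A step.prems(1) m(1) AF])
  \<comment> \<open>Here \<open>c\<close> is m. The pair entropy \<open>s2\<close> cancels when the
    two hypotheses are added, leaving the claim for m + 1.\<close>
  moreover have "((1 + c) - 2) * z + (1 + c) * s1 - ((1 + c) - 2) * s0 \<le> (1 + c) * y"
    if "(c - 2) * z + c * s2 - (c - 2) * s1 \<le> c * y" "c * (2 * s1 - s2 - s0) \<le> s1 + y - z - s0"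
    for c s0 s1 s2 y z :: real
    using that by (simp add: algebra_simps)
  ultimately show ?case
    unfolding of_nat_Suc diff_Suc_1 by blast
qed

section \<open>Exchangeable Lorentzian laws\<close>

lemma finite_set_pmf_tuples: "finite A \<Longrightarrow> set_pmf \<mu> \<subseteq> tuples A m \<Longrightarrow> finite (set_pmf \<mu>)"
  using finite_tuples finite_subset by blast

lemma permute_list_inj:
  assumes \<pi>: "\<pi> permutes {..<m}" and len: "length xs = m" "length ys = m"
    and eq: "permute_list \<pi> xs = permute_list \<pi> ys"
  shows "xs = ys"
proof -
  have inv: "permute_list (inv_into UNIV \<pi>) (permute_list \<pi> zs) = zs" if "length zs = m" for zs
    using permute_list_compose[of "inv_into UNIV \<pi>" zs \<pi>] permutes_inv[OF \<pi>] permutes_inv_o(1)[OF \<pi>] that by simp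
  show ?thesis
    using arg_cong[OF eq, of "permute_list (inv_into UNIV \<pi>)"]
    unfolding inv[OF len(1)] inv[OF len(2)] .
qed

lemma exchangeable_pmf_cong:
  assumes ex: "exchangeable m \<mu>" and supp: "set_pmf \<mu> \<subseteq> tuples A m"
    and eq: "mset \<omega> = mset \<omega>'" and len: "length \<omega> = m"
  shows "pmf \<mu> \<omega> = pmf \<mu> \<omega>'"
proof -
  have len': "length \<omega>' = m" using eq len by (metis size_mset)
  obtain \<pi> where \<pi>: "\<pi> permutes {..<m}" "permute_list \<pi> \<omega>' = \<omega>"
    using mset_eq_permutation[OF eq] len' by blast
  \<comment> \<open>Injectivity of \<open>permute_list \<pi>\<close> is available for lists of
    length \<open>m\<close>, so the preimage is cut down to the support.\<close>
  have pre: "permute_list \<pi> -` {\<omega>} \<inter> set_pmf \<mu> = {\<omega>'} \<inter> set_pmf \<mu>"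
    using permute_list_inj[OF \<pi>(1)] len' \<pi>(2) supp by (auto simp: tuples_def)
  have "pmf \<mu> \<omega> = pmf (map_pmf (permute_list \<pi>) \<mu>) \<omega>"
    using ex \<pi>(1) by (simp add: exchangeable_def)
  also have "\<dots> = measure (measure_pmf \<mu>) ({\<omega>'} \<inter> set_pmf \<mu>)"
    unfolding pmf_map pre[symmetric] by (rule measure_Int_set_pmf[symmetric])
  also have "\<dots> = pmf \<mu> \<omega>'"
    by (simp only: measure_Int_set_pmf measure_pmf_single)
  finally show ?thesis .
qed

lemma count_vector_mset: "count_vector \<omega> = mset_expvec (mset \<omega>)"
  by (rule poly_mapping_eqI) (simp add: lookup_count_vector count_mset)

lemma mset_expvec_eq_iff [simp]: "mset_expvec M = mset_expvec N \<longleftrightarrow> M = N"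
  by (metis lookup_mset_expvec multiset_eqI)

lemma lookup_count_gen_poly:
  "Poly_Mapping.lookup (count_gen_poly \<mu>) (mset_expvec M) = (\<Sum>\<omega>\<in>set_pmf \<mu>. if mset \<omega> = M then pmf \<mu> \<omega> else 0)"
  by (simp add: count_gen_poly_def lookup_sum lookup_single when_def count_vector_mset)

text \<open>The rearrangements of \<open>\<omega>\<close> have equal mass, and the multinomial
  coefficient counting them cancels the factorials in \<open>mset_coeff\<close> up to m!.\<close>

lemma mset_coeff_count_gen_poly:
  assumes A: "finite A" and ex: "exchangeable m \<mu>" and supp: "set_pmf \<mu> \<subseteq> tuples A m"
    and \<omega>: "\<omega> \<in> tuples A m"
  shows "mset_coeff A (count_gen_poly \<mu>) (mset \<omega>) = fact m * pmf \<mu> \<omega>"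
proof -
  let ?M = "mset \<omega>"
  have fin: "finite (set_pmf \<mu>)" by (rule finite_set_pmf_tuples[OF A supp])
  have "Poly_Mapping.lookup (count_gen_poly \<mu>) (mset_expvec ?M) =
      (\<Sum>\<omega>'\<in>set_pmf \<mu> \<inter> permutations_of_multiset ?M. pmf \<mu> \<omega>')"
    unfolding lookup_count_gen_poly permutations_of_multiset_def
    by (subst sum.inter_restrict[OF fin]) (intro sum.cong, auto)
  also have "\<dots> = (\<Sum>\<omega>'\<in>permutations_of_multiset ?M. pmf \<mu> \<omega>')"
    by (rule sum.mono_neutral_left) (auto simp: set_pmf_iff)
  also have "\<dots> = (\<Sum>\<omega>'\<in>permutations_of_multiset ?M. pmf \<mu> \<omega>)"
    by (intro sum.cong refl, rule exchangeable_pmf_cong[OF ex supp])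
       (use \<omega> in \<open>auto simp: permutations_of_multiset_def tuples_def dest: mset_eq_length\<close>)
  finally have lk: "Poly_Mapping.lookup (count_gen_poly \<mu>) (mset_expvec ?M) =
      real (card (permutations_of_multiset ?M)) * pmf \<mu> \<omega>" by simp
  have "(\<Prod>a\<in>A. fact (count ?M a)) = (\<Prod>a\<in>set_mset ?M. fact (count ?M a) :: nat)"
    using \<omega> A by (intro prod.mono_neutral_right) (auto simp: tuples_def count_mset)
  then have "card (permutations_of_multiset ?M) * (\<Prod>a\<in>A. fact (count ?M a)) = (fact m :: nat)"
    using card_permutations_of_multiset_aux[of ?M] \<omega> by (simp add: tuples_def)
  then have "real (card (permutations_of_multiset ?M) * (\<Prod>a\<in>A. fact (count ?M a))) = real (fact m)"
    by (rule arg_cong)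
  then have "real (card (permutations_of_multiset ?M)) * (\<Prod>a\<in>A. fact (count ?M a)) = fact m"
    by simp
  then show ?thesis unfolding mset_coeff_def lk by (simp add: mult_ac)
qed

lemma total_degree_count_gen_poly:
  assumes A: "finite A" and supp: "set_pmf \<mu> \<subseteq> tuples A m"
  shows "total_degree (count_gen_poly \<mu>) = m"
proof -
  have deg: "expvec_degree n = m" if n: "n \<in> Poly_Mapping.keys (count_gen_poly \<mu>)" for n
  proof -
    obtain M where M: "mset_expvec M = n" by (rule mset_expvec_surj)
    have "\<exists>\<omega>\<in>set_pmf \<mu>. mset \<omega> = M"
    proof (rule ccontr)
      assume "\<not> ?thesis"
      then have "Poly_Mapping.lookup (count_gen_poly \<mu>) (mset_expvec M) = 0"
        unfolding lookup_count_gen_poly by (intro sum.neutral) auto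
      then show False using n by (simp add: M in_keys_iff)
    qed
    then show ?thesis using supp by (auto simp: M[symmetric] expvec_degree_mset_expvec tuples_def)
  qed
  \<comment> \<open>The support of a \<open>pmf\<close> is nonempty, which rules out the zero
    polynomial with its conventional degree 0.\<close>
  obtain \<omega> where \<omega>: "\<omega> \<in> set_pmf \<mu>" using set_pmf_not_empty[of \<mu>] by auto
  have "0 < Poly_Mapping.lookup (count_gen_poly \<mu>) (mset_expvec (mset \<omega>))"
    unfolding lookup_count_gen_poly
    by (rule sum_pos2[OF finite_set_pmf_tuples[OF A supp] \<omega>]) (use \<omega> in \<open>auto simp: pmf_positive\<close>)
  then have "mset_expvec (mset \<omega>) \<in> Poly_Mapping.keys (count_gen_poly \<mu>)"
    by (simp add: in_keys_iff)
  then have "expvec_degree ` Poly_Mapping.keys (count_gen_poly \<mu>) = {m}"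
    using deg by auto
  then show ?thesis by (simp add: total_degree_def)
qed

section \<open>Shannon entropies of coordinates as tuple entropies\<close>

lemma shannon_entropy_superset:
  assumes "finite T" "set_pmf (map_pmf Y \<mu>) \<subseteq> T" "\<And>y. y \<in> T \<Longrightarrow> pmf (map_pmf Y \<mu>) y = p y"
  shows "shannon_entropy \<mu> Y = - (\<Sum>y\<in>T. p y * ln (p y))"
proof -
  have "(\<Sum>y\<in>set_pmf (map_pmf Y \<mu>). pmf (map_pmf Y \<mu>) y * ln (pmf (map_pmf Y \<mu>) y)) =
      (\<Sum>y\<in>T. pmf (map_pmf Y \<mu>) y * ln (pmf (map_pmf Y \<mu>) y))"
    by (rule sum.mono_neutral_left[OF assms(1,2)]) (simp add: set_pmf_iff del: set_map_pmf)
  then show ?thesis using assms(3) by (simp add: shannon_entropy_def)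
qed

lemma pmf_map_tuples:
  assumes A: "finite A" and supp: "set_pmf \<mu> \<subseteq> tuples A m"
  shows "pmf (map_pmf Y \<mu>) y = (\<Sum>\<omega>\<in>tuples A m. if Y \<omega> = y then pmf \<mu> \<omega> else 0)"
proof -
  have "pmf (map_pmf Y \<mu>) y = measure (measure_pmf \<mu>) (Y -` {y} \<inter> set_pmf \<mu>)"
    by (simp add: pmf_map measure_Int_set_pmf)
  also have "Y -` {y} \<inter> set_pmf \<mu> = (tuples A m \<inter> Y -` {y}) \<inter> set_pmf \<mu>"
    using supp by auto
  also have "measure (measure_pmf \<mu>) \<dots> = (\<Sum>\<omega>\<in>tuples A m \<inter> Y -` {y}. pmf \<mu> \<omega>)"
    unfolding measure_Int_set_pmf using finite_tuples[OF A]
    by (intro measure_measure_pmf_finite) auto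
  also have "\<dots> = (\<Sum>\<omega>\<in>tuples A m. if Y \<omega> = y then pmf \<mu> \<omega> else 0)"
    by (subst sum.inter_restrict[OF finite_tuples[OF A]]) (intro sum.cong, auto)
  finally show ?thesis .
qed

lemma delete_coord_append: "delete_coord (length xs) (xs @ a # ys) = xs @ ys"
  by (simp add: delete_coord_def nths_append nths_Cons nths_all)

lemma delete_coord_insert: "j \<le> length \<omega> \<Longrightarrow> delete_coord j (take j \<omega> @ a # drop j \<omega>) = \<omega>"
  using delete_coord_append[of "take j \<omega>" a "drop j \<omega>"] by simp

lemma delete_coord_take_drop:
  assumes "j < length \<omega>"
  shows "delete_coord j \<omega> = take j \<omega> @ drop (Suc j) \<omega>"
  using delete_coord_append[of "take j \<omega>" "\<omega> ! j" "drop (Suc j) \<omega>"] id_take_nth_drop[OF assms] assms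
  by simp

lemma delete_coord_tuples:
  assumes "\<omega> \<in> tuples A (Suc n)" "j \<le> n"
  shows "delete_coord j \<omega> \<in> tuples A n"
  using assms set_take_subset[of j \<omega>] set_drop_subset[of "Suc j" \<omega>]
  by (auto simp: tuples_def delete_coord_take_drop)

lemma sum_tuples_insert:
  assumes "j \<le> n"
  shows "(\<Sum>\<omega>\<in>tuples A (Suc n). F \<omega>) = (\<Sum>a\<in>A. \<Sum>\<omega>\<in>tuples A n. F (take j \<omega> @ a # drop j \<omega>))"
proof -
  have split: "\<omega> = take j \<omega> @ \<omega> ! j # drop (Suc j) \<omega>" if "\<omega> \<in> tuples A (Suc n)" for \<omega>
    using that assms by (intro id_take_nth_drop) (simp add: tuples_def)
  have del: "delete_coord j \<omega> = take j \<omega> @ drop (Suc j) \<omega>" if "\<omega> \<in> tuples A (Suc n)" for \<omega>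
    using that assms by (intro delete_coord_take_drop) (simp add: tuples_def)
  have "(\<Sum>\<omega>\<in>tuples A (Suc n). F \<omega>) = (\<Sum>(a, \<omega>)\<in>A \<times> tuples A n. F (take j \<omega> @ a # drop j \<omega>))"
  proof (rule sum.reindex_bij_witness[where i = "\<lambda>(a, \<omega>). take j \<omega> @ a # drop j \<omega>"
        and j = "\<lambda>\<omega>. (\<omega> ! j, delete_coord j \<omega>)"])
    fix \<omega> assume \<omega>: "\<omega> \<in> tuples A (Suc n)"
    then have len: "length \<omega> = Suc n" and set: "set \<omega> \<subseteq> A" by (auto simp: tuples_def)
    show eq: "(case (\<omega> ! j, delete_coord j \<omega>) of (a, \<omega>) \<Rightarrow> take j \<omega> @ a # drop j \<omega>) = \<omega>"
      using split[OF \<omega>] len assms by (simp add: del[OF \<omega>])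
    show "(\<omega> ! j, delete_coord j \<omega>) \<in> A \<times> tuples A n"
      using delete_coord_tuples[OF \<omega> assms] len set assms nth_mem[of j \<omega>] by auto
    show "(case (\<omega> ! j, delete_coord j \<omega>) of (a, \<omega>) \<Rightarrow> F (take j \<omega> @ a # drop j \<omega>)) = F \<omega>"
      using eq by simp
  next
    fix p assume p: "p \<in> A \<times> tuples A n"
    then obtain a \<omega> where a\<omega>: "p = (a, \<omega>)" "a \<in> A" "length \<omega> = n" "set \<omega> \<subseteq> A"
      by (auto simp: tuples_def)
    show "(case p of (a, \<omega>) \<Rightarrow> take j \<omega> @ a # drop j \<omega>) \<in> tuples A (Suc n)"
      using a\<omega> assms set_take_subset[of j \<omega>] set_drop_subset[of j \<omega>] by (auto simp: tuples_def)
    show "((case p of (a, \<omega>) \<Rightarrow> take j \<omega> @ a # drop j \<omega>) ! j,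
        delete_coord j (case p of (a, \<omega>) \<Rightarrow> take j \<omega> @ a # drop j \<omega>)) = p"
      using a\<omega> assms by (simp add: delete_coord_insert nth_append)
  qed
  then show ?thesis by (simp add: sum.cartesian_product)
qed

lemma mset_insert_coord: "mset (take j \<omega> @ a # drop j \<omega>) = add_mset a (mset \<omega>)"
proof -
  have "mset (take j \<omega>) + mset (drop j \<omega>) = mset \<omega>"
    by (metis append_take_drop_id mset_append)
  then show ?thesis by simp
qed

text \<open>Reinserting a letter at position \<open>j\<close> changes the multiset in the same way
  for every \<open>j\<close>, so the sums over \<open>j\<close> in the theorem have equal
  terms.\<close>

lemma shannon_entropy_marginals:
  assumes A: "finite A" and supp: "set_pmf \<mu> \<subseteq> tuples A (Suc n)" and j: "j \<le> n"
    and g: "\<And>\<omega>. \<omega> \<in> tuples A (Suc n) \<Longrightarrow> pmf \<mu> \<omega> = g (mset \<omega>)"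
  shows "shannon_entropy \<mu> (delete_coord j) = tuple_entropy A n (marginal A 1 g)"
    and "shannon_entropy \<mu> (\<lambda>X. X ! j) = tuple_entropy A 1 (marginal A n g)"
proof -
  have ins: "take j \<omega> @ a # drop j \<omega> \<in> tuples A (Suc n)" if "a \<in> A" "\<omega> \<in> tuples A n" for a \<omega>
    using that j set_take_subset[of j \<omega>] set_drop_subset[of j \<omega>] by (auto simp: tuples_def)
  have law: "pmf (map_pmf Y \<mu>) y =
      (\<Sum>a\<in>A. \<Sum>\<omega>\<in>tuples A n. if Y (take j \<omega> @ a # drop j \<omega>) = y then g (add_mset a (mset \<omega>)) else 0)"
    for Y :: "'a list \<Rightarrow> 'b" and y
    unfolding pmf_map_tuples[OF A supp] sum_tuples_insert[OF j]
    by (intro sum.cong refl) (simp add: g ins mset_insert_coord del: mset_append)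
  have supp1: "set_pmf (map_pmf (delete_coord j) \<mu>) \<subseteq> tuples A n"
    using supp delete_coord_tuples[OF _ j] by auto
  have "shannon_entropy \<mu> (delete_coord j) =
      - (\<Sum>y\<in>tuples A n. marginal A 1 g (mset y) * ln (marginal A 1 g (mset y)))"
  proof (rule shannon_entropy_superset[OF finite_tuples[OF A] supp1])
    fix y assume y: "y \<in> tuples A n"
    have "pmf (map_pmf (delete_coord j) \<mu>) y =
        (\<Sum>a\<in>A. \<Sum>\<omega>\<in>tuples A n. if \<omega> = y then g (add_mset a (mset \<omega>)) else 0)"
      unfolding law using j by (intro sum.cong refl) (simp add: delete_coord_insert tuples_def)
    also have "\<dots> = marginal A 1 g (mset y)"
      using y finite_tuples[OF A] by (simp add: marginal_Suc)
    finally show "pmf (map_pmf (delete_coord j) \<mu>) y = marginal A 1 g (mset y)" .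
  qed
  then show "shannon_entropy \<mu> (delete_coord j) = tuple_entropy A n (marginal A 1 g)"
    by (simp add: tuple_entropy_def)
  have "shannon_entropy \<mu> (\<lambda>X. X ! j) = - (\<Sum>b\<in>A. marginal A n g {#b#} * ln (marginal A n g {#b#}))"
  proof (rule shannon_entropy_superset[OF A])
    show "set_pmf (map_pmf (\<lambda>X. X ! j) \<mu>) \<subseteq> A"
      using supp j nth_mem by (fastforce simp: tuples_def)
    fix b assume b: "b \<in> A"
    have "pmf (map_pmf (\<lambda>X. X ! j) \<mu>) b =
        (\<Sum>a\<in>A. if a = b then \<Sum>\<omega>\<in>tuples A n. g (mset \<omega> + {#a#}) else 0)"
      unfolding law using j by (intro sum.cong refl) (auto simp: nth_append tuples_def intro!: sum.cong)
    also have "\<dots> = marginal A n g {#b#}"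
      using b A by (simp only: sum.delta sum_tuples_marginal if_True)
    finally show "pmf (map_pmf (\<lambda>X. X ! j) \<mu>) b = marginal A n g {#b#}" .
  qed
  then show "shannon_entropy \<mu> (\<lambda>X. X ! j) = tuple_entropy A 1 (marginal A n g)"
    unfolding tuple_entropy_1 .
qed

theorem lemma3p7:
  fixes A :: "'a set" and \<Omega> :: "nat \<Rightarrow> 'a list set" and m :: nat and \<mu> :: "'a list pmf"
  assumes "finite A"
    and "\<forall>k\<ge>1. \<Omega> k \<subseteq> tuples A k"
    and "permutation_invariant \<Omega>"
    and "deletion_compatible \<Omega>"
    and "m \<ge> 2"
    and "\<mu> \<in> exch_lorentzian_laws A \<Omega> m"
  shows "(\<Sum>j<m. shannon_entropy \<mu> (\<lambda>X. delete_coord j X))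
           \<ge> (real m - 2) * shannon_entropy \<mu> (\<lambda>X. X) + (\<Sum>j<m. shannon_entropy \<mu> (\<lambda>X. X ! j))"
proof -
  note A = assms(1)
  have ex: "exchangeable m \<mu>" and lor: "lorentzian A (count_gen_poly \<mu>)" and supp: "set_pmf \<mu> \<subseteq> tuples A m"
    using spec[OF assms(2), of m] assms(5,6) by (auto simp: exch_lorentzian_laws_def)
  \<comment> \<open>The factor cancels the \<open>fact m\<close> of
    \<open>mset_coeff_count_gen_poly\<close>, so that \<open>g\<close> is the mass function
    itself.\<close>
  define g where "g M = 1 / fact m * mset_coeff A (count_gen_poly \<mu>) M" for M
  have g: "pmf \<mu> \<omega> = g (mset \<omega>)" if "\<omega> \<in> tuples A m" for \<omega>
    by (simp add: g_def mset_coeff_count_gen_poly[OF A ex supp that])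
  have "count_gen_poly \<mu> \<in> nonneg_polys A" using lor by cases auto
  then have g0: "0 \<le> g M" for M by (simp add: g_def mset_coeff_nonneg)
  have AF: "alexandrov_fenchel A m g"
    unfolding g_def[abs_def]
    using lorentzian_alexandrov_fenchel[OF A lor] assms(5)
    by (intro alexandrov_fenchel_scale) (simp add: total_degree_count_gen_poly[OF A supp])
  obtain n where n: "m = Suc n" using assms(5) by (cases m) auto
  \<comment> \<open>Total mass 1 makes the mass correction in
    \<open>tuple_entropy_inequality\<close> vanish, since ln 1 = 0.\<close>
  have "marginal A m g {#} = (\<Sum>\<omega>\<in>tuples A m. pmf \<mu> \<omega>)"
    using sum_tuples_marginal[of g "{#}" A m] g by simp
  also have "\<dots> = 1" by (rule sum_pmf_eq_1[OF finite_tuples[OF A] supp])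
  finally have S0: "tuple_entropy A 0 (marginal A m g) = 0" by (simp add: tuple_entropy_0)
  have Sm: "shannon_entropy \<mu> (\<lambda>X. X) = tuple_entropy A m g"
    unfolding tuple_entropy_def
    by (rule shannon_entropy_superset[OF finite_tuples[OF A]]) (simp_all add: supp g)
  have S1: "shannon_entropy \<mu> (delete_coord j) = tuple_entropy A (m - 1) (marginal A 1 g)"
      "shannon_entropy \<mu> (\<lambda>X. X ! j) = tuple_entropy A 1 (marginal A (m - 1) g)" if "j < m" for j
    using shannon_entropy_marginals[OF A supp[unfolded n], of j g] that g by (auto simp: n)
  show ?thesis
    using tuple_entropy_inequality[OF A g0 assms(5) AF] by (simp add: S0 Sm S1)
qed

end
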